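(* Let $p,\tau\in(0,1/2)$ be reals, and let $\alpha=\mathrm{H}(p)$ and $\beta=\mathrm{H}(N(p,\tau))$. Let $X$ be an infinite bit sequence of effective Hausdorff dimension at least $\alpha$. Let $N_\tau(X)$ be the random sequence obtained from $X$ by flipping each bit of $X$ independently with probability $\tau$. Then with probability $1$ the effective Hausdorff dimension of $N_\tau(X)$ is at least $\beta$.
   Context: $\mathrm{C}(x)$ denotes the plain Kolmogorov complexity of the binary string $x$ (minimal length of a program producing $x$ for a fixed optimal programming language). The effective Hausdorff dimension of an infinite bit sequence $X=x_1x_2x_3\ldots$ is $\liminf_{n\to\infty}\mathrm{C}(x_1\ldots x_n)/n$. $\mathrm{H}(p)=-p\log p-(1-p)\log(1-p)$ is the binary Shannon entropy function (logarithms base 2), and $N(p,\tau)=p+\tau-2p\tau$. *)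

theory Defs
  imports "HOL-Probability.Probability"
begin

text \<open>Kleene's partial recursive functions. There are no arity annotations: a term applied to an
  argument list of unsuitable length simply has no value. The first argument is the recursion
  variable of \<open>Prec\<close> and the search variable of \<open>Mn\<close>.\<close>

datatype recf = Zero | Succ | Proj nat | Comp recf "recf list" | Prec recf recf | Mn recf

inductive reval :: "recf \<Rightarrow> nat list \<Rightarrow> nat \<Rightarrow> bool" where
  Zero: "reval Zero xs 0"
| Succ: "reval Succ [x] (Suc x)"
| Proj: "i < length xs \<Longrightarrow> reval (Proj i) xs (xs ! i)"
| Comp: "list_all2 (\<lambda>g y. reval g xs y) gs ys \<Longrightarrow> reval f ys z \<Longrightarrow> reval (Comp f gs) xs z"
| Prec_0: "reval f xs y \<Longrightarrow> reval (Prec f g) (0 # xs) y"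
| Prec_Suc: "reval (Prec f g) (n # xs) y \<Longrightarrow> reval g (n # y # xs) z \<Longrightarrow>
    reval (Prec f g) (Suc n # xs) z"
| Mn: "reval f (n # xs) 0 \<Longrightarrow> (\<And>i. i < n \<Longrightarrow> \<exists>y. reval f (i # xs) (Suc y)) \<Longrightarrow>
    reval (Mn f) xs n"

lemma reval_deterministic: "reval f xs y \<Longrightarrow> reval f xs z \<Longrightarrow> y = z"
proof (induction arbitrary: z rule: reval.induct)
  case (Comp xs gs ys f y)
  from Comp.prems obtain ys' where ys': "list_all2 (\<lambda>g y. reval g xs y) gs ys'" "reval f ys' z"
    by (cases rule: reval.cases) auto
  have "ys = ys'"
    using Comp.IH(1) ys'(1) by (auto simp: list_all2_conv_all_nth intro!: nth_equalityI)
  then show ?case using Comp.IH(2) ys'(2) by blast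
next
  case (Mn f n xs)
  from Mn.prems have z: "reval f (z # xs) 0" "\<And>i. i < z \<Longrightarrow> \<exists>y. reval f (i # xs) (Suc y)"
    by (cases rule: reval.cases; auto)+
  show ?case
  proof (rule linorder_cases[of n z])
    assume "n < z"
    then show ?thesis using z(2) Mn.IH(1) by fastforce
  next
    assume "z < n"
    then show ?thesis using z(1) Mn.IH(2) by fastforce
  qed
next
  case (Prec_Suc f g n xs y w)
  from Prec_Suc.prems obtain y' where "reval (Prec f g) (n # xs) y'" "reval g (n # y' # xs) z"
    by (cases rule: reval.cases) auto
  then show ?case using Prec_Suc.IH by blast
next
  case (Zero xs)
  then show ?case by (cases rule: reval.cases) auto
next
  case (Succ x)
  then show ?case by (cases rule: reval.cases) auto
next
  case (Proj i xs)
  from Proj.prems show ?case by (cases rule: reval.cases) auto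
next
  case (Prec_0 f xs y g)
  from Prec_0.prems have "reval f xs z" by (cases rule: reval.cases) auto
  then show ?case by (rule Prec_0.IH)
qed

text \<open>Binary strings are identified with natural numbers by bijective base-2 numeration.\<close>

fun code :: "bool list \<Rightarrow> nat" where
  "code [] = 0"
| "code (b # bs) = 2 * code bs + (if b then 2 else 1)"

lemma bij_code: "bij code"
proof (rule bijI)
  have "code x = code y \<Longrightarrow> x = y" for x y
  proof (induction x arbitrary: y)
    case Nil
    then show ?case by (cases y) (auto split: if_splits)
  next
    case (Cons b x)
    then obtain c z where y: "y = c # z"
      by (cases y) (auto split: if_splits)
    have "2 * code x + (if b then 2 else 1) = 2 * code z + (if c then 2 else 1)"
      using Cons.prems y by simp
    then have "b = c \<and> code x = code z"
      by (cases b; cases c; simp; presburger)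
    then show ?case using Cons.IH y by blast
  qed
  then show "inj code" by (rule injI)
  have "\<exists>x. code x = n" for n
  proof (induction n rule: less_induct)
    case (less n)
    show ?case
    proof (cases "n = 0")
      case True
      then show ?thesis by (metis code.simps(1))
    next
      case False
      then have "(n - 1) div 2 < n" by simp
      then obtain x where x: "code x = (n - 1) div 2"
        using less by blast
      have "2 * ((n - 1) div 2) + (if even n then 2 else 1) = n"
        using False by presburger
      then have "code (even n # x) = n"
        by (simp add: x)
      then show ?thesis by blast
    qed
  qed
  then show "surj code" by (metis surjI)
qed

definition partial_computable :: "(bool list \<Rightarrow> bool list option) \<Rightarrow> bool" where
  "partial_computable V \<longleftrightarrow> (\<exists>f. \<forall>p x. V p = Some x \<longleftrightarrow> reval f [code p] (code x))"

text \<open>\<open>\<infinity>\<close> if there is no program for \<open>x\<close>.\<close>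

definition complexity :: "(bool list \<Rightarrow> bool list option) \<Rightarrow> bool list \<Rightarrow> enat" where
  "complexity V x = (INF p\<in>{p. V p = Some x}. enat (length p))"

definition optimal :: "(bool list \<Rightarrow> bool list option) \<Rightarrow> bool" where
  "optimal U \<longleftrightarrow> partial_computable U \<and>
     (\<forall>V. partial_computable V \<longrightarrow>
        (\<exists>c::nat. \<forall>x. complexity U x \<le> complexity V x + enat c))"

definition eff_dim :: "(bool list \<Rightarrow> bool list option) \<Rightarrow> (nat \<Rightarrow> bool) \<Rightarrow> ereal" where
  "eff_dim U X =
     liminf (\<lambda>n. ereal_of_enat (complexity U (map X [0..<n])) / ereal (real n))"

definition entropy2 :: "real \<Rightarrow> real" where
  "entropy2 p = - p * log 2 p - (1 - p) * log 2 (1 - p)"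

definition noisy_bias :: "real \<Rightarrow> real \<Rightarrow> real" where
  "noisy_bias p \<tau> = p + \<tau> - 2 * p * \<tau>"

text \<open>A sample \<open>F\<close> marks the positions that are flipped.\<close>

definition flips :: "real \<Rightarrow> (nat \<Rightarrow> bool) measure" where
  "flips \<tau> = (\<Pi>\<^sub>M i\<in>UNIV. measure_pmf (bernoulli_pmf \<tau>))"

definition flip :: "(nat \<Rightarrow> bool) \<Rightarrow> (nat \<Rightarrow> bool) \<Rightarrow> nat \<Rightarrow> bool" where
  "flip X F i = (if F i then \<not> X i else X i)"

end

theory Submission
  imports Defs "HOL-Real_Asymp.Real_Asymp"
begin

text \<open>Fix a rational \<open>\<beta>' < \<beta>\<close> and let \<open>B\<close> be the set of strings of length \<open>n\<close> with complexity below
  \<open>\<beta>' n\<close>. Let \<open>A\<close> be the set of those \<open>x\<close> of length \<open>n\<close> whose noisy version lies in \<open>B\<close> with probability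
  at least \<open>\<rho>^n\<close>, for a constant \<open>\<rho> < 1\<close> close to \<open>1\<close>. The set \<open>A\<close> is enumerable, so its elements have
  complexity at most \<open>log (card A) + O(log n)\<close>. If \<open>card A \<le> 2^(\<alpha>' n)\<close> with \<open>\<alpha>' < \<alpha>\<close>, then almost all
  prefixes of \<open>X\<close> lie outside \<open>A\<close>, and the Borel--Cantelli lemma finishes the proof.

  The bound on \<open>card A\<close> comes from an \<open>L\<^sup>q\<close> estimate for the noise operator \<open>T\<close>, namely
  \<open>\<Sum>x. (T 1\<^sub>B x)^q \<le> M^n * (card B)^(1/s)\<close>. By Minkowski's inequality it tensorizes, hence follows from
  its instance for a single bit. There, letting \<open>q\<close> tend to infinity turns power means into geometric
  means, and Gibbs' inequality shows that the optimal \<open>M\<close> tends to the exponential of the maximum of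
  \<open>H x - H (N x \<tau>) / s\<close> over \<open>x\<close>. When \<open>s\<close> is the slope of the curve of points \<open>(H x, H (N x \<tau>))\<close> at
  \<open>x = p\<close>, this maximum is attained at \<open>p\<close>, because the curve is convex (Mrs. Gerber's lemma).\<close>

section \<open>Partial recursive functions\<close>

text \<open>Total functions of fixed arity \<open>k\<close> only; values on lists of other lengths
  are unconstrained. The list plays the role of an environment of variables.\<close>

definition computable :: "nat \<Rightarrow> (nat list \<Rightarrow> nat) \<Rightarrow> bool" where
  "computable k f \<longleftrightarrow> (\<exists>r. \<forall>xs. length xs = k \<longrightarrow> reval r xs (f xs))"

lemma computableI: "(\<And>xs. length xs = k \<Longrightarrow> reval r xs (f xs)) \<Longrightarrow> computable k f"
  by (auto simp: computable_def)

lemma computableE: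
  assumes "computable k f"
  obtains r where "\<forall>xs. length xs = k \<longrightarrow> reval r xs (f xs)"
  using assms by (auto simp: computable_def)

lemma computable_cong:
  "computable k f \<Longrightarrow> (\<And>xs. length xs = k \<Longrightarrow> f xs = g xs) \<Longrightarrow> computable k g"
  by (auto simp: computable_def)

lemma computable_nth: "i < k \<Longrightarrow> computable k (\<lambda>e. e ! i)"
  by (rule computableI[of _ "Proj i"]) (simp add: reval.Proj)

lemma computable_compose:
  assumes "computable (length fs) h" "\<And>f. f \<in> set fs \<Longrightarrow> computable k f"
  shows "computable k (\<lambda>e. h (map (\<lambda>f. f e) fs))"
proof -
  obtain r where r: "\<forall>xs. length xs = length fs \<longrightarrow> reval r xs (h xs)"
    using assms(1) by (rule computableE)
  have "\<forall>f\<in>set fs. \<exists>s. \<forall>xs. length xs = k \<longrightarrow> reval s xs (f xs)"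
    using assms(2) by (auto simp: computable_def)
  then obtain s where s: "\<And>f xs. f \<in> set fs \<Longrightarrow> length xs = k \<Longrightarrow> reval (s f) xs (f xs)"
    by metis
  show ?thesis
  proof (rule computableI[of _ "Comp r (map s fs)"])
    fix xs :: "nat list" assume "length xs = k"
    then have "list_all2 (\<lambda>g y. reval g xs y) (map s fs) (map (\<lambda>f. f xs) fs)"
      using s by (simp add: list_all2_conv_all_nth)
    then show "reval (Comp r (map s fs)) xs (h (map (\<lambda>f. f xs) fs))"
      by (rule reval.Comp) (simp add: r)
  qed
qed

text \<open>Change of environment: recursion and sums push new variables in front, and a body stated
  for another environment is reached by recomputing the first entries and keeping the last
  \<open>j\<close>.\<close>

lemma computable_append_drop:
  assumes "computable (length fs + j) h" "\<And>f. f \<in> set fs \<Longrightarrow> computable (d + j) f"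
  shows "computable (d + j) (\<lambda>e. h (map (\<lambda>f. f e) fs @ drop d e))"
proof -
  let ?fs = "fs @ map (\<lambda>i e. e ! i) [d..<d + j]"
  have "computable (d + j) (\<lambda>e. h (map (\<lambda>f. f e) ?fs))"
    by (rule computable_compose) (use assms in \<open>auto intro!: computable_nth\<close>)
  then show ?thesis
  proof (rule computable_cong)
    fix xs :: "nat list" assume "length xs = d + j"
    then have "map (\<lambda>i. xs ! i) [d..<d + j] = drop d xs"
      by (auto intro!: nth_equalityI)
    then show "h (map (\<lambda>f. f xs) ?fs) = h (map (\<lambda>f. f xs) fs @ drop d xs)"
      by (simp add: comp_def)
  qed
qed

lemma computable_drop: "computable k f \<Longrightarrow> computable (d + k) (\<lambda>e. f (drop d e))"
  using computable_append_drop[of "[]" k f d] by simp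

lemma computable_tl: "computable k f \<Longrightarrow> computable (Suc k) (\<lambda>e. f (tl e))"
  using computable_drop[of k f 1] by (simp add: drop_Suc)

lemma computable_Suc: "computable k f \<Longrightarrow> computable k (\<lambda>e. Suc (f e))"
proof -
  assume f: "computable k f"
  have "computable 1 (\<lambda>e. Suc (e ! 0))"
  proof (rule computableI[of _ Succ])
    fix xs :: "nat list" assume "length xs = 1"
    then obtain x where "xs = [x]" by (auto simp: length_Suc_conv)
    then show "reval Succ xs (Suc (xs ! 0))" by (simp add: reval.Succ)
  qed
  then show ?thesis
    using computable_compose[of "[f]" "\<lambda>e. Suc (e ! 0)" k] f by simp
qed

lemma computable_const: "computable k (\<lambda>_. c)"
proof (induction c)
  case 0
  show ?case by (rule computableI[of _ Zero]) (rule reval.Zero)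
next
  case (Suc c)
  then show ?case by (rule computable_Suc)
qed

lemma computable_prec:
  assumes "computable k f" "computable (Suc (Suc k)) g"
  shows "computable (Suc k) (\<lambda>e. rec_nat (f (tl e)) (\<lambda>n y. g (n # y # tl e)) (hd e))"
proof -
  obtain r where r: "\<forall>xs. length xs = k \<longrightarrow> reval r xs (f xs)"
    using assms(1) by (rule computableE)
  obtain s where s: "\<forall>xs. length xs = Suc (Suc k) \<longrightarrow> reval s xs (g xs)"
    using assms(2) by (rule computableE)
  have "reval (Prec r s) (n # xs) (rec_nat (f xs) (\<lambda>n y. g (n # y # xs)) n)"
    if "length xs = k" for n xs
  proof (induction n)
    case 0
    then show ?case using r that by (auto intro: reval.Prec_0)
  next
    case (Suc n)
    then show ?case using s that by (auto intro: reval.Prec_Suc)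
  qed
  then show ?thesis
    by (intro computableI[of _ "Prec r s"]) (auto simp: length_Suc_conv)
qed

text \<open>Recursion with a computed bound; the step sees the counter and the previous value in
  front of the environment. In this shape the rule applies directly to a \<open>rec_nat\<close>
  term, so such terms can be decomposed by introduction rules.\<close>

lemma computable_rec:
  assumes "computable k f" "computable (Suc (Suc k)) (\<lambda>e. g (hd e) (hd (tl e)) (tl (tl e)))"
    "computable k b"
  shows "computable k (\<lambda>e. rec_nat (f e) (\<lambda>n y. g n y e) (b e))"
  using computable_append_drop[of "[b]" k
      "\<lambda>e. rec_nat (f (tl e)) (\<lambda>n y. g n y (tl e)) (hd e)" 0]
    computable_prec[OF assms(1,2)] assms(3)
  by simp

lemma computable_hd: "0 < k \<Longrightarrow> computable k hd"
  by (rule computable_cong[OF computable_nth[of 0]]) (auto simp: hd_conv_nth)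

lemma computable_hd_tl: "1 < k \<Longrightarrow> computable k (\<lambda>e. hd (tl e))"
  using computable_tl[OF computable_hd, of "k - 1"] by simp

lemma computable_hd_tl_tl: "2 < k \<Longrightarrow> computable k (\<lambda>e. hd (tl (tl e)))"
  using computable_tl[OF computable_hd_tl, of "k - 1"] by simp

lemma computable_nth_tl: "i + 1 < k \<Longrightarrow> computable k (\<lambda>e. tl e ! i)"
  using computable_tl[OF computable_nth, of i "k - 1"] by simp

lemma computable_nth_tl_tl: "i + 2 < k \<Longrightarrow> computable k (\<lambda>e. tl (tl e) ! i)"
  using computable_tl[OF computable_nth_tl, of i "k - 1"] by simp

lemmas computable_vars = computable_const computable_nth computable_hd computable_hd_tl
  computable_hd_tl_tl computable_nth_tl computable_nth_tl_tl

lemma computable_tl_tl: "computable k f \<Longrightarrow> computable (Suc (Suc k)) (\<lambda>e. f (tl (tl e)))"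
  using computable_tl[OF computable_tl] by simp

section \<open>Arithmetic, case distinctions and bounded sums\<close>

lemma computable_add:
  assumes "computable k f" "computable k g"
  shows "computable k (\<lambda>e. f e + g e)"
proof -
  have *: "rec_nat x (\<lambda>n y. Suc y) n = x + n" for x n by (induction n) auto
  have "computable k (\<lambda>e. rec_nat (f e) (\<lambda>n y. Suc y) (g e))"
    by (intro computable_rec assms computable_Suc computable_vars) auto
  then show ?thesis by (simp add: *)
qed

lemma computable_diff:
  assumes "computable k f" "computable k g"
  shows "computable k (\<lambda>e. f e - g e)"
proof -
  \<comment> \<open>The predecessor is a recursion that discards the previous value and returns the
    counter; truncated subtraction iterates it.\<close>
  have 1: "rec_nat 0 (\<lambda>n y. n) m = m - 1" for m :: nat by (cases m) auto
  have 2: "rec_nat x (\<lambda>n y. y - 1) n = x - n" for x n :: nat by (induction n) auto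
  have "computable k (\<lambda>e. rec_nat (f e) (\<lambda>n y. rec_nat 0 (\<lambda>n y. n) y) (g e))"
    by (intro computable_rec assms computable_vars) auto
  then show ?thesis by (simp only: 1 2)
qed

lemma computable_mult:
  assumes "computable k f" "computable k g"
  shows "computable k (\<lambda>e. f e * g e)"
proof -
  have *: "rec_nat 0 (\<lambda>n y. y + m) n = m * n" for m n :: nat by (induction n) auto
  have "computable k (\<lambda>e. rec_nat 0 (\<lambda>n y. y + f e) (g e))"
    by (intro computable_rec assms computable_vars computable_add computable_tl_tl) auto
  then show ?thesis by (simp add: *)
qed

lemma computable_power:
  assumes "computable k f" "computable k g"
  shows "computable k (\<lambda>e. f e ^ g e)"
proof -
  have *: "rec_nat 1 (\<lambda>n y. y * m) n = m ^ n" for m n :: nat by (induction n) auto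
  have "computable k (\<lambda>e. rec_nat 1 (\<lambda>n y. y * f e) (g e))"
    by (intro computable_rec assms computable_vars computable_mult computable_tl_tl) auto
  then show ?thesis by (simp only: *)
qed

lemma computable_if_zero:
  assumes "computable k c" "computable k f" "computable k g"
  shows "computable k (\<lambda>e. if c e = 0 then f e else g e)"
proof -
  have *: "rec_nat x (\<lambda>_ _. y) n = (if n = 0 then x else y)" for x y n :: nat by (cases n) auto
  have "computable k (\<lambda>e. rec_nat (f e) (\<lambda>_ _. g e) (c e))"
    by (intro computable_rec assms computable_tl_tl)
  then show ?thesis by (simp add: *)
qed

lemma computable_if_le:
  assumes "computable k a" "computable k b" "computable k f" "computable k g"
  shows "computable k (\<lambda>e. if a e \<le> b e then f e else g e)"
  using computable_if_zero[OF computable_diff[OF assms(1,2)] assms(3,4)] by simp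

lemma computable_if_less:
  assumes "computable k a" "computable k b" "computable k f" "computable k g"
  shows "computable k (\<lambda>e. if a e < b e then f e else g e)"
  using computable_if_le[OF assms(2,1,4,3)] by (rule computable_cong) auto

lemma computable_if_eq:
  assumes "computable k a" "computable k b" "computable k f" "computable k g"
  shows "computable k (\<lambda>e. if a e = b e then f e else g e)"
  using computable_if_le[OF assms(1,2) computable_if_le[OF assms(2,1,3,4)] assms(4)]
  by (rule computable_cong) auto

lemma computable_sum:
  assumes "computable k b" "computable (Suc k) (\<lambda>e. f (hd e) (tl e))"
  shows "computable k (\<lambda>e. \<Sum>i<b e. f i e)"
proof -
  have *: "rec_nat 0 (\<lambda>n y. y + h n) m = (\<Sum>i<m. h i)" for h :: "nat \<Rightarrow> nat" and m
    by (induction m) auto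
  \<comment> \<open>The summand must not see the accumulator, which sits in second place: keep the
    counter and drop two entries.\<close>
  have "computable (Suc (Suc k)) (\<lambda>e. (\<lambda>e. f (hd e) (tl e)) (map (\<lambda>f. f e) [hd] @ drop 2 e))"
    using computable_append_drop[of "[hd]" k "\<lambda>e. f (hd e) (tl e)" 2] assms(2)
      computable_hd[of "Suc (Suc k)"]
    by simp
  then have "computable (Suc (Suc k)) (\<lambda>e. f (hd e) (tl (tl e)))"
    by (simp add: drop_Suc numeral_2_eq_2)
  then have "computable k (\<lambda>e. rec_nat 0 (\<lambda>n y. y + f n e) (b e))"
    by (intro computable_rec assms computable_vars computable_add) auto
  then show ?thesis by (simp add: *)
qed

lemma computable_div:
  assumes "computable k f" "computable k g"
  shows "computable k (\<lambda>e. f e div g e)"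
proof -
  \<comment> \<open>The quotient counts the positive multiples of \<open>y\<close> up to
    \<open>x\<close>. Division by zero gives 0, whereas for \<open>y = 0\<close> every
    \<open>i < x\<close> would be counted; hence the case distinction.\<close>
  have *: "(if y = 0 then 0 else (\<Sum>i<x. if Suc i * y \<le> x then 1 else 0)) = x div y" for x y :: nat
  proof (cases "y = 0")
    case False
    have "{i. i < x \<and> Suc i * y \<le> x} = {..<x div y}"
    proof (intro set_eqI iffI)
      fix i assume "i \<in> {i. i < x \<and> Suc i * y \<le> x}"
      then show "i \<in> {..<x div y}"
        using False by (simp add: less_eq_div_iff_mult_less_eq Suc_le_eq[symmetric] del: mult_Suc)
    next
      fix i assume i: "i \<in> {..<x div y}"
      then have "Suc i * y \<le> x"
        using False by (simp add: less_eq_div_iff_mult_less_eq Suc_le_eq[symmetric] del: mult_Suc)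
      moreover have "i < x" using i div_le_dividend[of x y] by (simp only: lessThan_iff)
      ultimately show "i \<in> {i. i < x \<and> Suc i * y \<le> x}" by simp
    qed
    then show ?thesis using False
      by (simp add: sum.If_cases Int_def lessThan_def del: mult_Suc)
  qed simp
  have "computable k (\<lambda>e. if g e = 0 then 0 else (\<Sum>i<f e. if Suc i * g e \<le> f e then 1 else 0))"
    by (intro computable_if_zero computable_sum computable_if_le computable_mult computable_Suc
        assms computable_vars computable_tl) auto
  then show ?thesis by (simp only: *)
qed

lemma computable_mod:
  assumes "computable k f" "computable k g"
  shows "computable k (\<lambda>e. f e mod g e)"
proof -
  have "computable k (\<lambda>e. f e - g e * (f e div g e))"
    by (intro computable_diff computable_mult computable_div assms)
  then show ?thesis by (simp add: minus_mult_div_eq_mod)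
qed

lemmas computable_intros = computable_add computable_diff computable_mult computable_power
  computable_div computable_mod computable_if_zero computable_if_le computable_if_less
  computable_if_eq computable_sum computable_Suc computable_vars

section \<open>Evaluation of partial recursive functions with bounded search\<close>

lemma computable_prod_list:
  "(\<And>f. f \<in> set fs \<Longrightarrow> computable k (h f)) \<Longrightarrow> computable k (\<lambda>e. prod_list (map (\<lambda>f. h f e) fs))"
  by (induction fs) (auto intro!: computable_intros)

text \<open>The first argument \<open>t\<close> of \<open>g\<close> is fuel, bounding only the searches of \<open>Mn\<close>. The result \<open>0\<close> means
  that there is no value yet, and \<open>Suc y\<close> encodes the value \<open>y\<close>. No universal function is needed:
  each \<open>f\<close> gets its own total \<open>g\<close>, by recursion on the structure of \<open>f\<close>.\<close>

definition fuel_eval :: "nat \<Rightarrow> recf \<Rightarrow> (nat list \<Rightarrow> nat) \<Rightarrow> bool" where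
  "fuel_eval k f g \<longleftrightarrow> computable (Suc k) g \<and>
     (\<forall>xs s t y. length xs = k \<longrightarrow> s \<le> t \<longrightarrow> g (s # xs) = Suc y \<longrightarrow> g (t # xs) = Suc y) \<and>
     (\<forall>xs y. length xs = k \<longrightarrow> (reval f xs y \<longleftrightarrow> (\<exists>t. g (t # xs) = Suc y)))"

lemma fuel_evalI:
  assumes "computable (Suc k) g"
    "\<And>xs s t y. length xs = k \<Longrightarrow> s \<le> t \<Longrightarrow> g (s # xs) = Suc y \<Longrightarrow> g (t # xs) = Suc y"
    "\<And>xs y t. length xs = k \<Longrightarrow> g (t # xs) = Suc y \<Longrightarrow> reval f xs y"
    "\<And>xs y. length xs = k \<Longrightarrow> reval f xs y \<Longrightarrow> \<exists>t. g (t # xs) = Suc y"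
  shows "fuel_eval k f g"
  using assms unfolding fuel_eval_def by metis

lemma fuel_evalD:
  assumes "fuel_eval k f g"
  shows "computable (Suc k) g"
    "length xs = k \<Longrightarrow> s \<le> t \<Longrightarrow> g (s # xs) = Suc y \<Longrightarrow> g (t # xs) = Suc y"
    "length xs = k \<Longrightarrow> reval f xs y \<longleftrightarrow> (\<exists>t. g (t # xs) = Suc y)"
  using assms unfolding fuel_eval_def by metis+

text \<open>All stages of the recursion share the same fuel, and 0 propagates as "no value yet". If
  the stages need different fuels, their maximum serves for all by monotonicity. In the argument
  list, fuel comes first, then the recursion variable, then the parameters.\<close>

lemma fuel_eval_Prec:
  assumes f: "fuel_eval k f F" and g: "fuel_eval (Suc (Suc k)) g G"
  defines "R \<equiv> \<lambda>t xs. rec_nat (F (t # xs)) (\<lambda>m y. if y = 0 then 0 else G (t # m # (y - 1) # xs))"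
  shows "fuel_eval (Suc k) (Prec f g) (\<lambda>e. R (e ! 0) (drop 2 e) (e ! 1))"
proof -
  have R_Suc: "R t xs (Suc n) = Suc y \<longleftrightarrow> (\<exists>z. R t xs n = Suc z \<and> G (t # n # z # xs) = Suc y)"
    for t xs n y
    by (cases "R t xs n") (auto simp: R_def)
  have R_0: "R t xs 0 = F (t # xs)" for t xs
    by (simp add: R_def)
  have mono: "R t xs n = Suc y" if "R s xs n = Suc y" "s \<le> t" "length xs = k" for s t xs n y
    using that(1)
  proof (induction n arbitrary: y)
    case 0
    then show ?case using fuel_evalD(2)[OF f that(3,2)] by (simp add: R_0)
  next
    case (Suc n)
    then obtain z where "R s xs n = Suc z" "G (s # n # z # xs) = Suc y" by (auto simp: R_Suc)
    then show ?case
      using Suc.IH fuel_evalD(2)[OF g _ that(2), of "n # z # xs" y] that(3) by (auto simp: R_Suc)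
  qed
  show ?thesis
  proof (rule fuel_evalI)
    have 1: "computable (Suc (Suc k)) (\<lambda>e. F (map (\<lambda>f. f e) [\<lambda>e. e ! 0] @ drop 2 e))"
      using computable_append_drop[of "[\<lambda>e. e ! 0]" k F 2] fuel_evalD(1)[OF f]
      by (simp add: computable_nth)
    \<comment> \<open>Inside the recursion the environment is: counter, encoded previous value,
      fuel, recursion argument, parameters.\<close>
    have 2: "computable (4 + k) (\<lambda>e. G (map (\<lambda>f. f e) [\<lambda>e. e ! 2, hd, \<lambda>e. hd (tl e) - 1] @ drop 4 e))"
      by (rule computable_append_drop)
        (use fuel_evalD(1)[OF g] in \<open>auto intro!: computable_intros simp: numeral_3_eq_3\<close>)
    have 3: "computable (Suc (Suc (Suc (Suc k))))
      (\<lambda>e. G (tl (tl e) ! 0 # hd e # (hd (tl e) - 1) # drop 2 (tl (tl e))))"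
    proof (rule computable_cong)
      show "computable (Suc (Suc (Suc (Suc k)))) (\<lambda>e. G (map (\<lambda>f. f e) [\<lambda>e. e ! 2, hd, \<lambda>e. hd (tl e) - 1] @ drop 4 e))"
        using 2 by (simp add: numeral_eq_Suc)
    qed (auto simp: length_Suc_conv numeral_eq_Suc)
    show "computable (Suc (Suc k)) (\<lambda>e. R (e ! 0) (drop 2 e) (e ! 1))"
      unfolding R_def using 1 3
      by (intro computable_rec computable_if_zero computable_vars) auto
  next
    fix xs s t y
    assume xs: "length xs = Suc k" "s \<le> t"
      "R ((s # xs) ! 0) (drop 2 (s # xs)) ((s # xs) ! 1) = Suc y"
    then show "R ((t # xs) ! 0) (drop 2 (t # xs)) ((t # xs) ! 1) = Suc y"
      using mono[of s "drop 2 (s # xs)" _ y t] by simp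
  next
    have "reval (Prec f g) (n # xs) y" if "length xs = k" "R t xs n = Suc y" for t xs n y
      using that(2)
    proof (induction n arbitrary: y)
      case 0
      then show ?case using that(1) fuel_evalD(3)[OF f]
        by (auto simp: R_0 intro!: reval.Prec_0)
    next
      case (Suc n)
      then obtain z where z: "R t xs n = Suc z" "G (t # n # z # xs) = Suc y"
        by (auto simp: R_Suc)
      then have "reval g (n # z # xs) y"
        using fuel_evalD(3)[OF g, of "n # z # xs"] that(1) by auto
      then show ?case using Suc.IH[OF z(1)] by (rule reval.Prec_Suc[rotated])
    qed
    then show "reval (Prec f g) xs y"
      if "length xs = Suc k" "R ((t # xs) ! 0) (drop 2 (t # xs)) ((t # xs) ! 1) = Suc y" for xs y t
      using that by (auto simp: length_Suc_conv)
  next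
    have "\<exists>t. R t xs n = Suc y" if "length xs = k" "reval (Prec f g) (n # xs) y" for xs n y
      using that(2)
    proof (induction n arbitrary: y)
      case 0
      then have "reval f xs y" by (cases rule: reval.cases) auto
      then show ?case using fuel_evalD(3)[OF f] that(1) by (auto simp: R_0)
    next
      case (Suc n)
      from Suc.prems obtain z where z: "reval (Prec f g) (n # xs) z" "reval g (n # z # xs) y"
        by (cases rule: reval.cases) auto
      from Suc.IH[OF z(1)] obtain s where s: "R s xs n = Suc z" by auto
      have "length (n # z # xs) = Suc (Suc k)" using that(1) by simp
      from fuel_evalD(3)[OF g this] obtain t where t: "G (t # n # z # xs) = Suc y"
        using z(2) by blast
      have "R (max s t) xs n = Suc z" using mono[OF s _ that(1), of "max s t"] by simp
      moreover have "G (max s t # n # z # xs) = Suc y"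
        using fuel_evalD(2)[OF g _ _ t, of "max s t"] that(1) by simp
      ultimately show ?case by (intro exI[of _ "max s t"]) (simp add: R_Suc)
    qed
    then show "\<exists>t. R ((t # xs) ! 0) (drop 2 (t # xs)) ((t # xs) ! 1) = Suc y"
      if "length xs = Suc k" "reval (Prec f g) xs y" for xs y
      using that by (auto simp: length_Suc_conv)
  qed
qed

text \<open>Fuel \<open>t\<close> limits the search to \<open>n \<le> t\<close>. As values are
  shifted by one, \<open>F = 1\<close> means a zero has been found and \<open>F > 1\<close> a
  positive value. Only the least zero with all earlier values known to be positive contributes, so
  the sum has at most one nonzero term, namely the encoded result.\<close>

lemma fuel_eval_Mn:
  assumes f: "fuel_eval (Suc k) f F"
  shows "fuel_eval k (Mn f) (\<lambda>e. \<Sum>n<Suc (hd e).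
    if F (hd e # n # tl e) = 1
    then if (\<Sum>i<n. if F (hd e # i # tl e) \<le> 1 then 1 else 0) = (0::nat) then Suc n else 0 else 0)"
    (is "fuel_eval k _ ?g")
proof -
  define Q where "Q t xs n \<longleftrightarrow> F (t # n # xs) = 1 \<and> (\<forall>i<n. 1 < F (t # i # xs))" for t n and xs :: "nat list"
  have g: "?g (t # xs) = Suc y \<longleftrightarrow> y \<le> t \<and> Q t xs y" for t xs y
  proof -
    have uniq: "Q t xs m \<Longrightarrow> Q t xs n \<Longrightarrow> m = n" for m n
      unfolding Q_def by (metis less_irrefl linorder_cases)
    have "?g (t # xs) = (\<Sum>n<Suc t. if Q t xs n then Suc n else 0)"
      by (intro sum.cong) (auto simp: Q_def not_le)
    also have "\<dots> = Suc y \<longleftrightarrow> y \<le> t \<and> Q t xs y"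
    proof (cases "\<exists>n\<le>t. Q t xs n")
      case True
      then obtain n where n: "n \<le> t" "Q t xs n" by auto
      have "(\<Sum>n<Suc t. if Q t xs n then Suc n else 0) = (\<Sum>m\<in>{n}. if Q t xs m then Suc m else 0)"
        by (rule sum.mono_neutral_right) (use n in \<open>auto dest: uniq[OF n(2)]\<close>)
      then have "(\<Sum>n<Suc t. if Q t xs n then Suc n else 0) = Suc n" using n by simp
      then show ?thesis using n uniq by (metis Suc_inject)
    next
      case False
      then have "(\<Sum>n<Suc t. if Q t xs n then Suc n else 0) = 0" by (intro sum.neutral) (auto simp: less_Suc_eq_le)
      then show ?thesis using False by (metis nat.distinct(1))
    qed
    finally show ?thesis .
  qed
  have mono: "Q t xs n" if "Q s xs n" "s \<le> t" "length xs = k" for s t xs n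
  proof -
    have *: "F (s # m # xs) = Suc y \<Longrightarrow> F (t # m # xs) = Suc y" for m y
      using fuel_evalD(2)[OF f _ that(2), of "m # xs" y] that(3) by simp
    have "1 < F (t # i # xs)" if "i < n" for i
    proof -
      have "1 < F (s # i # xs)" using \<open>Q s xs n\<close> that by (simp add: Q_def)
      then obtain z where "F (s # i # xs) = Suc (Suc z)" by (auto dest!: less_imp_Suc_add)
      from *[OF this] show ?thesis by simp
    qed
    then show ?thesis using that(1) *[of n 0] by (simp add: Q_def)
  qed
  show ?thesis
  proof (rule fuel_evalI)
    have "computable (3 + k) (\<lambda>e. F (map (\<lambda>f. f e) [\<lambda>e. hd (tl (tl e)), hd] @ drop 3 e))"
      by (rule computable_append_drop)
        (use fuel_evalD(1)[OF f] in \<open>auto intro!: computable_intros simp: numeral_3_eq_3\<close>)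
    then have 3: "computable (Suc (Suc (Suc k))) (\<lambda>e. F (hd (tl (tl e)) # hd e # tl (tl (tl e))))"
      by (simp add: numeral_3_eq_3 drop_Suc)
    have "computable (2 + k) (\<lambda>e. F (map (\<lambda>f. f e) [\<lambda>e. hd (tl e), hd] @ drop 2 e))"
      by (rule computable_append_drop)
        (use fuel_evalD(1)[OF f] in \<open>auto intro!: computable_intros\<close>)
    then have 2: "computable (Suc (Suc k)) (\<lambda>e. F (hd (tl e) # hd e # tl (tl e)))"
      by (simp add: numeral_2_eq_2 drop_Suc)
    show "computable (Suc k) ?g"
      using 2 3 by (intro computable_sum computable_if_zero computable_if_le computable_if_eq
        computable_Suc computable_vars) auto
  next
    show "?g (t # xs) = Suc y" if "length xs = k" "s \<le> t" "?g (s # xs) = Suc y" for xs s t y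
      using that mono unfolding g by auto
  next
    show "reval (Mn f) xs y" if "length xs = k" "?g (t # xs) = Suc y" for xs y t
    proof (rule reval.Mn)
      have Q: "Q t xs y" using that(2) unfolding g by blast
      then show "reval f (y # xs) 0"
        using fuel_evalD(3)[OF f, of "y # xs"] that(1) by (auto simp: Q_def)
      fix i assume "i < y"
      then have "1 < F (t # i # xs)" using Q by (auto simp: Q_def)
      then obtain z where "F (t # i # xs) = Suc (Suc z)"
        by (auto dest!: less_imp_Suc_add)
      then show "\<exists>z. reval f (i # xs) (Suc z)"
        using fuel_evalD(3)[OF f, of "i # xs"] that(1) by auto
    qed
  next
    fix xs y assume xs: "length xs = k" and "reval (Mn f) xs y"
    from this(2) have r: "reval f (y # xs) 0" "\<And>i. i < y \<Longrightarrow> \<exists>z. reval f (i # xs) (Suc z)"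
      by (cases rule: reval.cases; auto)+
    have F: "reval f (i # xs) z \<longleftrightarrow> (\<exists>t. F (t # i # xs) = Suc z)" for i z
      using fuel_evalD(3)[OF f, of "i # xs"] xs by simp
    have "\<forall>i\<in>{..y}. \<exists>t z. F (t # i # xs) = Suc z"
    proof
      fix i assume "i \<in> {..y}"
      then have "i < y \<or> i = y" by auto
      then have "\<exists>z. reval f (i # xs) z" using r by blast
      then show "\<exists>t z. F (t # i # xs) = Suc z" using F by blast
    qed
    then obtain t where t: "\<forall>i\<in>{..y}. \<exists>z. F (t i # i # xs) = Suc z"
      by (rule bchoice[THEN exE])
    \<comment> \<open>One fuel that reaches the candidate \<open>y\<close> and suffices for the
      evaluations at all \<open>i \<le> y\<close>.\<close>
    define T where "T = y + (\<Sum>i\<le>y. t i)"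
    have T: "y \<le> T" by (simp add: T_def)
    have "\<exists>z. F (T # i # xs) = Suc z \<and> reval f (i # xs) z" if i: "i \<le> y" for i
    proof -
      have "t i \<le> (\<Sum>i\<le>y. t i)" using i by (intro member_le_sum) auto
      then have "t i \<le> T" by (simp add: T_def)
      moreover obtain z where "F (t i # i # xs) = Suc z" using bspec[OF t, of i] i by auto
      ultimately have "F (T # i # xs) = Suc z"
        using fuel_evalD(2)[OF f, of "i # xs" "t i" T z] xs by simp
      then show ?thesis using F by blast
    qed
    note F_T = this
    obtain z where z: "F (T # y # xs) = Suc z" "reval f (y # xs) z" using F_T[of y] by auto
    have "F (T # y # xs) = 1"
      using reval_deterministic[OF r(1) z(2)] z(1) by simp
    moreover have "1 < F (T # i # xs)" if i: "i < y" for i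
    proof -
      obtain z where z: "F (T # i # xs) = Suc z" "reval f (i # xs) z"
        using F_T[of i] i by auto
      obtain z' where "reval f (i # xs) (Suc z')" using r(2)[OF i] by auto
      from reval_deterministic[OF this z(2)] z(1) show ?thesis by simp
    qed
    ultimately have "Q T xs y" by (simp add: Q_def)
    then show "\<exists>t. ?g (t # xs) = Suc y" using T unfolding g by blast
  qed
qed

text \<open>The product serves as a conjunction: it vanishes exactly when some component has no
  value yet. As before, maxima of fuels combine the finitely many evaluations.\<close>

lemma fuel_eval_Comp:
  assumes f: "fuel_eval (length gs) f F" and g: "\<And>g. g \<in> set gs \<Longrightarrow> fuel_eval k g (G g)"
  shows "fuel_eval k (Comp f gs) (\<lambda>e. if prod_list (map (\<lambda>g. G g e) gs) = 0 then 0
    else F (hd e # map (\<lambda>g. G g e - 1) gs))" (is "fuel_eval k _ ?h")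
proof -
  have h: "?h (t # xs) = Suc y \<longleftrightarrow>
      (\<exists>ys. list_all2 (\<lambda>g z. G g (t # xs) = Suc z) gs ys \<and> F (t # ys) = Suc y)" for t xs y
  proof
    assume "?h (t # xs) = Suc y"
    then have "\<forall>g\<in>set gs. G g (t # xs) \<noteq> 0" "F (t # map (\<lambda>g. G g (t # xs) - 1) gs) = Suc y"
      by (auto simp: prod_list_zero_iff split: if_splits)
    then show "\<exists>ys. list_all2 (\<lambda>g z. G g (t # xs) = Suc z) gs ys \<and> F (t # ys) = Suc y"
      by (intro exI[of _ "map (\<lambda>g. G g (t # xs) - 1) gs"]) (auto simp: list_all2_conv_all_nth)
  next
    assume "\<exists>ys. list_all2 (\<lambda>g z. G g (t # xs) = Suc z) gs ys \<and> F (t # ys) = Suc y"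
    then obtain ys where ys: "list_all2 (\<lambda>g z. G g (t # xs) = Suc z) gs ys" "F (t # ys) = Suc y"
      by auto
    then have "map (\<lambda>g. G g (t # xs) - 1) gs = ys"
      by (auto simp: list_all2_conv_all_nth intro!: nth_equalityI)
    moreover have "prod_list (map (\<lambda>g. G g (t # xs)) gs) \<noteq> 0"
      using ys(1) by (auto simp: prod_list_zero_iff in_set_conv_nth list_all2_conv_all_nth)
    ultimately show "?h (t # xs) = Suc y" using ys(2) by simp
  qed
  show ?thesis
  proof (rule fuel_evalI)
    have "computable (Suc k) (\<lambda>e. F (map (\<lambda>f. f e) (hd # map (\<lambda>g e. G g e - 1) gs)))"
      by (rule computable_compose)
        (use fuel_evalD(1)[OF f] fuel_evalD(1)[OF g] in \<open>auto intro!: computable_intros\<close>)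
    then have "computable (Suc k) (\<lambda>e. F (hd e # map (\<lambda>g. G g e - 1) gs))"
      by (simp add: comp_def)
    then show "computable (Suc k) ?h"
      using fuel_evalD(1)[OF g] by (intro computable_if_zero computable_prod_list computable_vars)
  next
    fix xs s t y assume *: "length xs = k" "s \<le> t" and s: "?h (s # xs) = Suc y"
    then obtain ys where ys: "list_all2 (\<lambda>g z. G g (s # xs) = Suc z) gs ys" "F (s # ys) = Suc y"
      using h by auto
    have "list_all2 (\<lambda>g z. G g (t # xs) = Suc z) gs ys"
      using ys(1) by (rule list.rel_mono_strong) (use * in \<open>auto intro!: fuel_evalD(2)[OF g, where s = s]\<close>)
    moreover have "F (t # ys) = Suc y"
      using fuel_evalD(2)[OF f _ *(2) ys(2)] list_all2_lengthD[OF ys(1)] by simp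
    ultimately show "?h (t # xs) = Suc y" unfolding h by blast
  next
    fix xs y t assume "length xs = k" "?h (t # xs) = Suc y"
    then obtain ys where ys: "list_all2 (\<lambda>g z. G g (t # xs) = Suc z) gs ys" "F (t # ys) = Suc y"
      using h by auto
    have "list_all2 (\<lambda>g y. reval g xs y) gs ys"
      using ys(1) fuel_evalD(3)[OF g] \<open>length xs = k\<close>
      by (elim list.rel_mono_strong) blast
    moreover have "reval f ys y"
      using fuel_evalD(3)[OF f] ys list_all2_lengthD by fastforce
    ultimately show "reval (Comp f gs) xs y" by (rule reval.Comp)
  next
    fix xs z assume xs: "length xs = k" and "reval (Comp f gs) xs z"
    from this(2) obtain ys where ys: "list_all2 (\<lambda>g y. reval g xs y) gs ys" "reval f ys z"
      by (cases rule: reval.cases) auto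
    obtain t where t: "F (t # ys) = Suc z"
      using fuel_evalD(3)[OF f, of ys] ys list_all2_lengthD by fastforce
    have "\<exists>T. list_all2 (\<lambda>g z. G g (T # xs) = Suc z) gs' ys'"
      if "list_all2 (\<lambda>g y. reval g xs y) gs' ys'" "set gs' \<subseteq> set gs" for gs' ys'
      using that
    proof (induction rule: list_all2_induct)
      case Nil
      then show ?case by simp
    next
      case (Cons g gs' y ys')
      then obtain T where T: "list_all2 (\<lambda>g z. G g (T # xs) = Suc z) gs' ys'" by auto
      obtain S where S: "G g (S # xs) = Suc y"
        using fuel_evalD(3)[OF g] Cons xs by fastforce
      have "list_all2 (\<lambda>g z. G g (max S T # xs) = Suc z) gs' ys'"
        using T by (rule list.rel_mono_strong)
          (use Cons.prems xs in \<open>auto intro!: fuel_evalD(2)[OF g, where s = T]\<close>)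
      moreover have "G g (max S T # xs) = Suc y"
        using S Cons.prems xs by (auto intro!: fuel_evalD(2)[OF g, where s = S])
      ultimately show ?case by (intro exI[of _ "max S T"]) simp
    qed
    from this[OF ys(1)] obtain T where T: "list_all2 (\<lambda>g z. G g (T # xs) = Suc z) gs ys" by auto
    have "list_all2 (\<lambda>g z. G g (max t T # xs) = Suc z) gs ys"
      using T by (rule list.rel_mono_strong) (use xs in \<open>auto intro!: fuel_evalD(2)[OF g, where s = T]\<close>)
    moreover have "F (max t T # ys) = Suc z"
      using fuel_evalD(2)[OF f _ _ t] list_all2_lengthD[OF T] by simp
    ultimately show "\<exists>t. ?h (t # xs) = Suc z" using h by blast
  qed
qed

text \<open>For terms applied at an unsuitable arity, such as \<open>Prec\<close> without arguments
  or \<open>Proj i\<close> beyond the list.\<close>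

lemma fuel_eval_undefined:
  assumes "\<And>xs y. length xs = k \<Longrightarrow> \<not> reval f xs y"
  shows "fuel_eval k f (\<lambda>_. 0)"
  by (rule fuel_evalI) (use assms in \<open>auto intro: computable_const\<close>)

lemma fuel_eval_exists: "\<exists>g. fuel_eval k f g"
proof (induction f arbitrary: k)
  case Zero
  have "fuel_eval k Zero (\<lambda>_. 1)"
    by (rule fuel_evalI) (auto intro: computable_const reval.Zero elim: reval.cases)
  then show ?case by blast
next
  case Succ
  show ?case
  proof (cases "k = 1")
    case True
    have "fuel_eval 1 Succ (\<lambda>e. Suc (Suc (e ! 1)))"
      by (rule fuel_evalI)
        (auto intro!: computable_intros simp: length_Suc_conv reval.Succ elim: reval.cases)
    then show ?thesis using True by blast
  next
    case False
    then have "fuel_eval k Succ (\<lambda>_. 0)"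
      by (intro fuel_eval_undefined) (auto elim: reval.cases)
    then show ?thesis by blast
  qed
next
  case (Proj i)
  show ?case
  proof (cases "i < k")
    case True
    then have "fuel_eval k (Proj i) (\<lambda>e. Suc (e ! Suc i))"
      by (intro fuel_evalI) (auto intro!: computable_intros simp: reval.Proj elim: reval.cases)
    then show ?thesis by blast
  next
    case False
    then have "fuel_eval k (Proj i) (\<lambda>_. 0)"
      by (intro fuel_eval_undefined) (auto elim: reval.cases)
    then show ?thesis by blast
  qed
next
  case (Comp f gs)
  obtain F where "fuel_eval (length gs) f F" using Comp by blast
  moreover have "\<forall>g\<in>set gs. \<exists>G. fuel_eval k g G" using Comp by blast
  then obtain G where "\<forall>g\<in>set gs. fuel_eval k g (G g)" by (rule bchoice[THEN exE])
  ultimately show ?case using fuel_eval_Comp by blast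
next
  case (Prec f g)
  show ?case
  proof (cases k)
    case 0
    then have "fuel_eval k (Prec f g) (\<lambda>_. 0)"
      by (intro fuel_eval_undefined) (auto elim: reval.cases)
    then show ?thesis by blast
  next
    case (Suc k')
    then show ?thesis using fuel_eval_Prec Prec by blast
  qed
next
  case (Mn f)
  then show ?case using fuel_eval_Mn by blast
qed

section \<open>Enumerating strings that are likely to become simple\<close>

text \<open>Bijective base-2 numeration plus one is ordinary binary with an extra leading 1, least
  significant bit first. Hence \<open>2 ^ length p \<le> code p + 1 < 2 ^ (length p + 1)\<close>,
  the link between program length and program number.\<close>

lemma code_eq: "code x + 1 = 2 ^ length x + horner_sum of_bool 2 x"
  by (induction x) auto

abbreviation bits_val :: "bool list \<Rightarrow> nat" where
  "bits_val \<equiv> horner_sum of_bool 2"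

lemma bits_val_less: "bits_val x < 2 ^ length x"
  using horner_sum_of_bool_2_less[of x] by (simp only: of_nat_less_iff of_nat_power of_nat_numeral)

lemma bits_val_digit: "j < length x \<Longrightarrow> bits_val x div 2 ^ j mod 2 = of_bool (x ! j)"
proof (induction x arbitrary: j)
  case (Cons b x)
  then show ?case by (cases j) (auto simp: div_mult2_eq)
qed simp

lemma bits_val_inj: "length x = length y \<Longrightarrow> bits_val x = bits_val y \<Longrightarrow> x = y"
  by (intro nth_equalityI) (metis bits_val_digit of_bool_eq_iff)+

lemma bij_betw_bits_val: "bij_betw bits_val {x. length x = n} {..<2 ^ n}"
proof -
  have inj: "inj_on bits_val {x. length x = n}"
    by (intro inj_onI bits_val_inj) auto
  have "card (bits_val ` {x. length x = n}) = 2 ^ n"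
    using card_lists_length_eq[of "UNIV :: bool set" n] card_image[OF inj] by simp
  then have "bits_val ` {x. length x = n} = {..<2 ^ n}"
    using bits_val_less by (intro card_subset_eq) auto
  then show ?thesis using inj by (simp add: bij_betw_def)
qed

section \<open>Heavy sets and their semidecidability\<close>

definition hamming :: "bool list \<Rightarrow> bool list \<Rightarrow> nat" where
  "hamming x y = (\<Sum>i<length x. if x ! i = y ! i then 0 else 1)"

lemma hamming_le: "hamming x y \<le> length x"
  unfolding hamming_def by (rule order_trans[OF sum_mono[of _ _ "\<lambda>_. 1"]]) auto

lemma hamming_bits_val:
  assumes "length x = n" "length y = n"
  shows "hamming x y = (\<Sum>j<n. if bits_val x div 2 ^ j mod 2 = bits_val y div 2 ^ j mod 2 then 0 else 1)"
  unfolding hamming_def assms(1) using assms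
  by (intro sum.cong) (auto simp: bits_val_digit)

text \<open>Programs are bounded by number instead of length: this turns the search into a bounded
  sum and limits the cardinality to \<open>R n\<close>. For \<open>R n = 2 ^ m\<close> all programs
  shorter than \<open>m\<close> are included.\<close>

definition describable :: "(bool list \<Rightarrow> bool list option) \<Rightarrow> (nat \<Rightarrow> nat) \<Rightarrow> nat \<Rightarrow> bool list set" where
  "describable U R n = {y. length y = n \<and> (\<exists>p. U p = Some y \<and> code p < R n)}"

text \<open>The noise level may be an uncomputable real, so the weights \<open>a\<close>, \<open>b\<close> and the threshold \<open>L\<close> are
  integers; they stand for \<open>D * \<tau>\<close>, \<open>D * (1 - \<tau>)\<close> and slightly less than \<open>D\<close> for a large \<open>D\<close>.\<close>

definition heavy :: "nat \<Rightarrow> nat \<Rightarrow> nat \<Rightarrow> (nat \<Rightarrow> bool list set) \<Rightarrow> nat \<Rightarrow> bool list set" where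
  "heavy a b L B n =
     {x. length x = n \<and> L ^ n \<le> (\<Sum>y\<in>B n. a ^ hamming x y * b ^ (n - hamming x y))}"

lemma describable_subset: "describable U R n \<subseteq> {y. length y = n}"
  by (auto simp: describable_def)

lemma finite_length: "finite {y :: bool list. length y = n}"
  using finite_lists_length_eq[of "UNIV :: bool set" n] by simp

text \<open>With fuel \<open>t\<close> only finitely many computations are inspected, which yields a
  decidable set \<open>Bt t\<close> of strings found so far. These sets increase to the finite set
  \<open>describable U R n\<close> and reach it at some \<open>t\<close>, so the weight passes the
  threshold at some stage exactly when the full weight does.\<close>

lemma heavy_semidecidable:
  assumes U: "partial_computable U" and R: "computable 1 (\<lambda>e. R (e ! 0))"
  shows "\<exists>D. computable 3 D \<and>
    (\<forall>x. x \<in> heavy a b L (describable U R) (length x) \<longleftrightarrow> (\<exists>t. D [t, length x, bits_val x] \<noteq> 0))"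
proof -
  obtain f where f: "\<And>p x. U p = Some x \<longleftrightarrow> reval f [code p] (code x)"
    using U by (auto simp: partial_computable_def)
  obtain g where g: "fuel_eval 1 f g" using fuel_eval_exists by blast
  \<comment> \<open>\<open>v + 2 ^ n\<close> is one more than the code of the string of length
    \<open>n\<close> with binary value \<open>v\<close>, hence the encoding of that output in
    \<open>g\<close>.\<close>
  define B where "B t n v \<longleftrightarrow> (\<Sum>P<R n. if g [t, P] = v + 2 ^ n then 1 else 0) \<noteq> (0::nat)" for t n v
  have B: "B t n v \<longleftrightarrow> (\<exists>P<R n. g [t, P] = v + 2 ^ n)" for t n v
    by (auto simp: B_def)
  define d where "d n v w = (\<Sum>j<n. if v div 2 ^ j mod 2 = w div 2 ^ j mod 2 then 0 else (1::nat))" for n v w :: nat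
  define Z where "Z t n v = (\<Sum>w<2 ^ n. if (\<Sum>P<R n. if g [t, P] = w + 2 ^ n then 1 else 0) = (0::nat) then 0
    else a ^ d n v w * b ^ (n - d n v w))" for t n v
  have g2: "computable k (\<lambda>e. g [p e, q e])" if "computable k p" "computable k q" for k p q
    using computable_compose[of "[p, q]" g k] fuel_evalD(1)[OF g] that by (auto simp: numeral_2_eq_2)
  have R1: "computable k (\<lambda>e. R (p e))" if "computable k p" for k p
    using computable_compose[of "[p]" "\<lambda>e. R (e ! 0)" k] R that by auto
  have "computable 3 (\<lambda>e. if L ^ (e ! 1) \<le> Z (e ! 0) (e ! 1) (e ! 2) then 1 else 0)"
    unfolding Z_def d_def
    by (intro computable_if_le computable_sum computable_if_zero computable_if_eq computable_power
      computable_mult computable_diff computable_add computable_div computable_mod g2 R1 computable_vars) auto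
  moreover have "x \<in> heavy a b L (describable U R) (length x) \<longleftrightarrow>
    (\<exists>t. L ^ length x \<le> Z t (length x) (bits_val x))" for x
  proof -
    define n where "n = length x"
    let ?c = "\<lambda>y. a ^ hamming x y * b ^ (n - hamming x y)"
    define Bt where "Bt t = {y. length y = n \<and> B t n (bits_val y)}" for t
    have Z: "Z t n (bits_val x) = (\<Sum>y\<in>Bt t. ?c y)" for t
    proof -
      have "Z t n (bits_val x) = (\<Sum>y\<in>{y. length y = n}. if B t n (bits_val y) then ?c y else 0)"
        unfolding Z_def sum.reindex_bij_betw[OF bij_betw_bits_val, symmetric]
        by (intro sum.cong) (auto simp: B_def d_def hamming_bits_val n_def)
      also have "\<dots> = (\<Sum>y\<in>Bt t. ?c y)"
        by (simp add: Bt_def sum.inter_filter[OF finite_length, symmetric])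
      finally show ?thesis .
    qed
    have desc: "y \<in> describable U R n \<longleftrightarrow> length y = n \<and> (\<exists>t. B t n (bits_val y))" for y
    proof -
      have "(\<exists>p. U p = Some y \<and> code p < R n) \<longleftrightarrow> (\<exists>P<R n. reval f [P] (code y))"
      proof
        assume "\<exists>p. U p = Some y \<and> code p < R n"
        then show "\<exists>P<R n. reval f [P] (code y)" using f by blast
      next
        assume "\<exists>P<R n. reval f [P] (code y)"
        then obtain P where P: "P < R n" "reval f [P] (code y)" by blast
        obtain p where "code p = P" using bij_code by (metis bij_pointE)
        then show "\<exists>p. U p = Some y \<and> code p < R n" using f[of p y] P by blast
      qed
      also have "\<dots> \<longleftrightarrow> (\<exists>P<R n. \<exists>t. g [t, P] = Suc (code y))"
        using fuel_evalD(3)[OF g] by auto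
      finally have eq: "(\<exists>p. U p = Some y \<and> code p < R n) \<longleftrightarrow> (\<exists>P<R n. \<exists>t. g [t, P] = Suc (code y))" .
      show ?thesis
      proof (cases "length y = n")
        case True
        then have "Suc (code y) = bits_val y + 2 ^ n" using code_eq[of y] by simp
        with eq True show ?thesis unfolding describable_def B by auto
      qed (simp add: describable_def)
    qed
    have mono: "Bt s \<subseteq> Bt t" if "s \<le> t" for s t
    proof
      fix y assume "y \<in> Bt s"
      then obtain P where y: "length y = n" "P < R n" and "g [s, P] = bits_val y + 2 ^ n" by (auto simp: Bt_def B)
      moreover have "bits_val y + 2 ^ n = Suc (code y)"
        using code_eq[of y] \<open>length y = n\<close> by simp
      ultimately have "g [t, P] = bits_val y + 2 ^ n"
        using fuel_evalD(2)[OF g _ that, of "[P]" "code y"] by simp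
      then show "y \<in> Bt t" using y by (auto simp: Bt_def B)
    qed
    have fin: "finite (describable U R n)"
      by (rule finite_subset[OF describable_subset finite_length])
    have sub: "Bt t \<subseteq> describable U R n" for t
      using desc by (auto simp: Bt_def)
    have "\<exists>t. describable U R n \<subseteq> Bt t"
    proof -
      have "\<forall>y\<in>describable U R n. \<exists>t. y \<in> Bt t" using desc by (auto simp: Bt_def)
      then obtain T where T: "\<forall>y\<in>describable U R n. y \<in> Bt (T y)" by (rule bchoice[THEN exE])
      have "y \<in> Bt (sum T (describable U R n))" if "y \<in> describable U R n" for y
      proof -
        have "T y \<le> sum T (describable U R n)" using that fin by (intro member_le_sum) auto
        from mono[OF this] bspec[OF T that] show ?thesis by blast
      qed
      then show ?thesis by blast
    qed
    then obtain t where t: "Bt t = describable U R n" using sub by blast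
    have "x \<in> heavy a b L (describable U R) n \<longleftrightarrow> L ^ n \<le> (\<Sum>y\<in>describable U R n. ?c y)"
      by (simp add: heavy_def n_def)
    also have "\<dots> \<longleftrightarrow> (\<exists>t. L ^ n \<le> (\<Sum>y\<in>Bt t. ?c y))"
    proof
      assume "L ^ n \<le> sum ?c (describable U R n)"
      then show "\<exists>t. L ^ n \<le> sum ?c (Bt t)" by (intro exI[of _ t]) (simp only: t)
    next
      assume "\<exists>t. L ^ n \<le> sum ?c (Bt t)"
      then obtain t where "L ^ n \<le> sum ?c (Bt t)" ..
      also have "\<dots> \<le> sum ?c (describable U R n)" by (rule sum_mono2[OF fin sub]) simp
      finally show "L ^ n \<le> sum ?c (describable U R n)" .
    qed
    finally show ?thesis unfolding n_def[symmetric] Z .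
  qed
  ultimately show ?thesis
    by (intro exI[of _ "\<lambda>e. if L ^ (e ! 1) \<le> Z (e ! 0) (e ! 1) (e ! 2) then 1 else 0"]) simp
qed

text \<open>The number \<open>N = n * G n + i\<close> with \<open>i < G n\<close> encodes the \<open>i\<close>-th element of the \<open>n\<close>-th set in order
  of appearance, so that \<open>n\<close> costs only a logarithmic number of bits. The enumeration runs through
  all \<open>s = t * 2 ^ n + v\<close>.\<close>

lemma enumerator:
  assumes D: "computable 3 D" and G: "computable 1 (\<lambda>e. G (e ! 0))"
    and mono: "mono G" and pos: "\<And>n. 0 < G n"
    and card: "\<And>n. card {v. v < 2 ^ n \<and> (\<exists>t. D [t, n, v] \<noteq> 0)} \<le> G n"
  shows "\<exists>r. \<forall>n v t. v < 2 ^ n \<longrightarrow> D [t, n, v] \<noteq> 0 \<longrightarrow>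
    (\<exists>N. N < (n + 1) * G n \<and> reval r [N] (v + 2 ^ n - 1))"
proof -
  define hit where "hit n s = D [s div 2 ^ n, n, s mod 2 ^ n]" for n s
  \<comment> \<open>Marks the stage at which the element \<open>s mod 2 ^ n\<close> appears for the
    first time, so that repetitions are not counted.\<close>
  define new where "new n s = (if hit n s = 0 then 0 else if (\<Sum>j<s. if j mod 2 ^ n = s mod 2 ^ n
    then if hit n j = 0 then 0 else 1 else 0) = (0::nat) then (1::nat) else 0)" for n s
  have new: "new n s = of_bool (hit n s \<noteq> 0 \<and> (\<forall>j<s. j mod 2 ^ n = s mod 2 ^ n \<longrightarrow> hit n j = 0))" for n s
    by (auto simp: new_def)
  have newD: "hit n s \<noteq> 0" "j < s \<Longrightarrow> j mod 2 ^ n = s mod 2 ^ n \<Longrightarrow> hit n j = 0"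
    if "new n s = 1" for n s j
    using that by (auto simp: new of_bool_def split: if_splits)
  define cnt where "cnt n s = (\<Sum>j<s. new n j)" for n s
  \<comment> \<open>Recovers \<open>n\<close> from \<open>N\<close>: block \<open>n\<close> begins
    at \<open>n * G n\<close>, and these starting points increase because \<open>G\<close> is
    monotone.\<close>
  define blk where "blk N = (\<Sum>j<N. if (j + 1) * G (j + 1) \<le> N then 1 else (0::nat))" for N
  have D3: "computable k (\<lambda>e. D [p e, q e, r e])"
    if "computable k p" "computable k q" "computable k r" for k p q r
    using computable_compose[of "[p, q, r]" D k] D that by (auto simp: numeral_3_eq_3)
  have G1: "computable k (\<lambda>e. G (p e))" if "computable k p" for k p
    using computable_compose[of "[p]" "\<lambda>e. G (e ! 0)" k] G that by auto
  have blk1: "computable 1 (\<lambda>e. blk (e ! 0))"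
    unfolding blk_def
    by (intro computable_sum computable_if_le computable_mult computable_add G1 computable_vars) auto
  have blk1: "computable k (\<lambda>e. blk (p e))" if "computable k p" for k p
    using computable_compose[of "[p]" "\<lambda>e. blk (e ! 0)" k] blk1 that by auto
  have cnt2: "computable 2 (\<lambda>e. cnt (e ! 0) (e ! 1))"
    unfolding cnt_def new_def hit_def
    by (intro computable_sum computable_if_zero computable_if_eq computable_mod computable_div
      computable_power D3 computable_vars) auto
  have cnt2: "computable k (\<lambda>e. cnt (p e) (q e))" if "computable k p" "computable k q" for k p q
    using computable_compose[of "[p, q]" "\<lambda>e. cnt (e ! 0) (e ! 1)" k] cnt2 that
    by (auto simp: numeral_2_eq_2)
  \<comment> \<open>For \<open>n = blk N\<close>, this difference becomes zero at the first
    \<open>s\<close> by which more than \<open>N - n * G n\<close> elements have appeared, that is,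
    when the element of index \<open>N - n * G n\<close>, counted from zero, shows up. Minimization
    finds this \<open>s\<close>.\<close>
  have "computable 2 (\<lambda>e. Suc (e ! 1) - blk (e ! 1) * G (blk (e ! 1)) - cnt (blk (e ! 1)) (Suc (e ! 0)))"
    by (intro computable_diff computable_Suc computable_mult blk1 G1 cnt2 computable_vars) auto
  then obtain test where "\<forall>xs. length xs = 2 \<longrightarrow> reval test xs
      (Suc (xs ! 1) - blk (xs ! 1) * G (blk (xs ! 1)) - cnt (blk (xs ! 1)) (Suc (xs ! 0)))"
    by (rule computableE)
  from this[rule_format, of "[s, N]" for s N]
  have test: "reval test [s, N] (Suc N - blk N * G (blk N) - cnt (blk N) (Suc s))" for s N
    by simp
  \<comment> \<open>The code of the string of length \<open>blk N\<close> whose binary value was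
    found.\<close>
  have "computable 2 (\<lambda>e. e ! 0 mod 2 ^ blk (e ! 1) + 2 ^ blk (e ! 1) - 1)"
    by (intro computable_diff computable_add computable_mod computable_power blk1 computable_vars) auto
  then obtain out where "\<forall>xs. length xs = 2 \<longrightarrow>
      reval out xs (xs ! 0 mod 2 ^ blk (xs ! 1) + 2 ^ blk (xs ! 1) - 1)"
    by (rule computableE)
  from this[rule_format, of "[s, N]" for s N]
  have out: "reval out [s, N] (s mod 2 ^ blk N + 2 ^ blk N - 1)" for s N
    by simp
  have run: "reval (Comp out [Mn test, Proj 0]) [N] (s mod 2 ^ n + 2 ^ n - 1)"
    if N: "blk N = n" "N = n * G n + cnt n s" and s: "new n s = 1" for N n s
  proof (rule reval.Comp)
    have cntmono: "cnt n i \<le> cnt n j" if "i \<le> j" for i j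
      unfolding cnt_def by (rule sum_mono2) (use that in auto)
    have "reval (Mn test) [N] s"
    proof (rule reval.Mn)
      have "Suc N - blk N * G (blk N) - cnt (blk N) (Suc s) = 0"
        using N s by (simp add: cnt_def)
      then show "reval test [s, N] 0" using test[of s N] by simp
      fix i assume "i < s"
      then have "cnt n (Suc i) \<le> cnt n s" by (intro cntmono) simp
      then have "Suc N - blk N * G (blk N) - cnt (blk N) (Suc i)
          = Suc (cnt n s - cnt n (Suc i))"
        unfolding N(1) unfolding N(2) by simp
      then show "\<exists>y. reval test [i, N] (Suc y)" using test[of i N] by metis
    qed
    then show "list_all2 (\<lambda>g y. reval g [N] y) [Mn test, Proj 0] [s, N]"
      using reval.Proj[of 0 "[N]"] by simp
    show "reval out [s, N] (s mod 2 ^ n + 2 ^ n - 1)" using out[of s N] N(1) by simp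
  qed
  have "\<exists>N. N < (n + 1) * G n \<and> reval (Comp out [Mn test, Proj 0]) [N] (v + 2 ^ n - 1)"
    if v: "v < 2 ^ n" "D [t, n, v] \<noteq> 0" for n v t
  proof -
    have "\<exists>s. s mod 2 ^ n = v \<and> hit n s \<noteq> 0"
      by (rule exI[of _ "t * 2 ^ n + v"]) (use v in \<open>auto simp: hit_def\<close>)
    define s where "s = (LEAST s. s mod 2 ^ n = v \<and> hit n s \<noteq> 0)"
    have s: "s mod 2 ^ n = v" "hit n s \<noteq> 0"
      using LeastI_ex[OF \<open>\<exists>s. s mod 2 ^ n = v \<and> hit n s \<noteq> 0\<close>] by (auto simp: s_def)
    have "hit n j = 0" if "j < s" "j mod 2 ^ n = v" for j
      using not_less_Least[of j "\<lambda>s. s mod 2 ^ n = v \<and> hit n s \<noteq> 0"] that by (auto simp: s_def)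
    then have new_s: "new n s = 1" using s by (simp add: new)
    \<comment> \<open>New stages have distinct residues in the enumerated set, so there are at most
      \<open>G n\<close> of them. As \<open>s\<close> is one of them, strictly fewer than
      \<open>G n\<close> precede it.\<close>
    let ?S = "{j. j < Suc s \<and> new n j = 1}"
    have "cnt n (Suc s) = card ?S"
    proof -
      have "cnt n (Suc s) = (\<Sum>j<Suc s. if new n j = 1 then 1 else 0)"
        unfolding cnt_def by (intro sum.cong) (auto simp: new)
      also have "\<dots> = card ?S"
        by (subst sum.inter_filter[symmetric]) auto
      finally show ?thesis .
    qed
    also have "\<dots> \<le> card {v. v < 2 ^ n \<and> (\<exists>t. D [t, n, v] \<noteq> 0)}"
    proof (rule card_inj_on_le)
      show "inj_on (\<lambda>j. j mod 2 ^ n) ?S"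
      proof (rule linorder_inj_onI)
        fix i j assume "i < j" "i \<in> ?S" "j \<in> ?S"
        then show "i mod 2 ^ n \<noteq> j mod 2 ^ n" using newD[of n i] newD(2)[of n j i] by auto
      qed auto
      show "(\<lambda>j. j mod 2 ^ n) ` ?S \<subseteq> {v. v < 2 ^ n \<and> (\<exists>t. D [t, n, v] \<noteq> 0)}"
        using newD(1) by (auto simp: hit_def)
    qed simp
    also have "\<dots> \<le> G n" by (rule card)
    finally have lt: "cnt n s < G n" using new_s by (simp add: cnt_def)
    define N where "N = n * G n + cnt n s"
    have "{j. j < N \<and> (j + 1) * G (j + 1) \<le> N} = {..<n}"
    proof (intro set_eqI iffI)
      fix j assume j: "j \<in> {j. j < N \<and> (j + 1) * G (j + 1) \<le> N}"
      show "j \<in> {..<n}"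
      proof (rule ccontr)
        assume "j \<notin> {..<n}"
        then have "(n + 1) * G n \<le> (j + 1) * G (j + 1)"
          using monoD[OF mono, of n "j + 1"] by (intro mult_mono) auto
        also have "\<dots> \<le> N" using j by simp
        finally show False using lt by (simp add: N_def)
      qed
    next
      fix j assume j: "j \<in> {..<n}"
      then have "(j + 1) * G (j + 1) \<le> n * G n"
        using monoD[OF mono, of "j + 1" n] by (intro mult_mono) auto
      then have "(j + 1) * G (j + 1) \<le> N" unfolding N_def by linarith
      \<comment> \<open>The sum in \<open>blk\<close> only runs over \<open>j < N\<close>;
        positivity of \<open>G\<close> gives \<open>n \<le> N\<close>, so no block is
        missed.\<close>
      moreover have "n * 1 \<le> n * G n" using pos[of n] by (intro mult_le_mono2) simp
      then have "j < N" using j unfolding N_def lessThan_iff by linarith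
      ultimately show "j \<in> {j. j < N \<and> (j + 1) * G (j + 1) \<le> N}" by simp
    qed
    then have "blk N = n"
      unfolding blk_def by (subst sum.inter_filter[symmetric]) auto
    from run[OF this N_def new_s] s(1) lt show ?thesis
      by (intro exI[of _ N]) (auto simp: N_def)
  qed
  then show ?thesis by blast
qed

section \<open>From enumerations to complexity bounds\<close>

lemma partial_computable_machine:
  obtains V where "partial_computable V" "\<And>p x. V p = Some x \<longleftrightarrow> reval r [code p] (code x)"
proof
  let ?V = "\<lambda>p. if \<exists>x. reval r [code p] (code x) then Some (SOME x. reval r [code p] (code x)) else None"
  show V: "?V p = Some x \<longleftrightarrow> reval r [code p] (code x)" for p x
  proof -
    have "x = y" if "reval r [code p] (code x)" "reval r [code p] (code y)" for x y
      using reval_deterministic[OF that] bij_code by (auto dest: bij_is_inj injD)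
    then show ?thesis by (auto intro: someI_ex)
  qed
  then show "partial_computable ?V" unfolding partial_computable_def by blast
qed

text \<open>The program for \<open>x\<close> is the string with number \<open>N\<close>, its index
  in the enumeration; \<open>N < 2 ^ m\<close> forces length at most \<open>m\<close>. A single
  enumerator handles all \<open>n\<close>, so passing to the optimal \<open>U\<close> costs a
  constant independent of \<open>n\<close>.\<close>

lemma complexity_heavy:
  assumes U: "optimal U" and R: "computable 1 (\<lambda>e. R (e ! 0))" and G: "computable 1 (\<lambda>e. G (e ! 0))"
    and mono: "mono G" and pos: "\<And>n. 0 < G n"
    and card: "\<And>n. card (heavy a b L (describable U R) n) \<le> G n"
  shows "\<exists>c. \<forall>n m. \<forall>x\<in>heavy a b L (describable U R) n. (n + 1) * G n \<le> 2 ^ m \<longrightarrow>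
    complexity U x \<le> enat (m + c)"
proof -
  let ?H = "heavy a b L (describable U R)"
  obtain D where D: "computable 3 D"
    "\<And>x. x \<in> ?H (length x) \<longleftrightarrow> (\<exists>t. D [t, length x, bits_val x] \<noteq> 0)"
    using heavy_semidecidable[OF _ R, of U a b L] U by (auto simp: optimal_def)
  have "card {v. v < 2 ^ n \<and> (\<exists>t. D [t, n, v] \<noteq> 0)} \<le> G n" for n
  proof -
    have "{v. v < 2 ^ n \<and> (\<exists>t. D [t, n, v] \<noteq> 0)} \<subseteq> bits_val ` ?H n"
    proof
      fix v assume v: "v \<in> {v. v < 2 ^ n \<and> (\<exists>t. D [t, n, v] \<noteq> 0)}"
      then obtain x where "length x = n" "v = bits_val x"
        using bij_betw_bits_val[of n] by (auto simp: bij_betw_def)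
      then show "v \<in> bits_val ` ?H n" using v D(2)[of x] by auto
    qed
    moreover have "finite (?H n)"
      by (rule finite_subset[OF _ finite_length[of n]]) (auto simp: heavy_def)
    ultimately have "card {v. v < 2 ^ n \<and> (\<exists>t. D [t, n, v] \<noteq> 0)} \<le> card (?H n)"
      by (rule surj_card_le[rotated])
    then show ?thesis using card[of n] by simp
  qed
  from enumerator[OF D(1) G mono pos this] obtain r where
    r: "\<And>n v t. v < 2 ^ n \<Longrightarrow> D [t, n, v] \<noteq> 0 \<Longrightarrow> \<exists>N. N < (n + 1) * G n \<and> reval r [N] (v + 2 ^ n - 1)"
    by blast
  obtain V where V: "partial_computable V" "\<And>p x. V p = Some x \<longleftrightarrow> reval r [code p] (code x)"
    using partial_computable_machine[of r] by metis
  from V(1) obtain c where c: "\<forall>x. complexity U x \<le> complexity V x + enat c"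
    using U unfolding optimal_def by blast
  have "complexity U x \<le> enat (m + c)" if x: "x \<in> ?H n" and m: "(n + 1) * G n \<le> 2 ^ m" for n m x
  proof -
    have n: "length x = n" using x by (simp add: heavy_def)
    obtain t where "D [t, n, bits_val x] \<noteq> 0" using x D(2)[of x] n by auto
    from r[OF _ this] obtain N where N: "N < (n + 1) * G n" "reval r [N] (bits_val x + 2 ^ n - 1)"
      using bits_val_less[of x] n by auto
    have "bits_val x + 2 ^ n - 1 = code x" using code_eq[of x] n by simp
    obtain p where p: "code p = N" using bij_code by (metis bij_pointE)
    have "V p = Some x" using V(2)[of p x] N(2) p \<open>bits_val x + 2 ^ n - 1 = code x\<close> by simp
    then have "complexity V x \<le> enat (length p)"
      unfolding complexity_def by (intro INF_lower) auto
    moreover have "length p \<le> m"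
    proof -
      have "2 ^ length p \<le> N + 1" using code_eq[of p] p by simp
      also have "\<dots> \<le> 2 ^ m" using N(1) m by simp
      finally show ?thesis by simp
    qed
    ultimately have "complexity V x + enat c \<le> enat (m + c)"
      by (metis add_right_mono enat_ord_simps(1) order_trans plus_enat_simps(1))
    then show ?thesis using spec[OF c, of x] by (rule order_trans[rotated])
  qed
  then show ?thesis by blast
qed

section \<open>The two-point inequality\<close>

definition nat_entropy :: "real \<Rightarrow> real" where
  "nat_entropy x = - x * ln x - (1 - x) * ln (1 - x)"

text \<open>The derivative of the entropy, hence the negative of the customary logit; it is positive
  on \<open>(0, 1/2)\<close>.\<close>

definition logit :: "real \<Rightarrow> real" where
  "logit x = ln (1 - x) - ln x"

lemma has_derivative_nat_entropy:
  assumes "0 < x" "x < 1"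
  shows "(nat_entropy has_real_derivative logit x) (at x)"
  unfolding nat_entropy_def logit_def using assms
  by (auto intro!: derivative_eq_intros)

lemma has_derivative_logit:
  assumes "0 < x" "x < 1"
  shows "(logit has_real_derivative - (1 / (x * (1 - x)))) (at x)"
  unfolding logit_def using assms
  by (auto intro!: derivative_eq_intros simp: field_simps)

text \<open>Both sides agree at 1/2, and since \<open>x * (1 - x) \<le> 1/4\<close> the left side
  never descends faster than the right one.\<close>

lemma logit_lower_bound:
  assumes "0 < y" "y < 1/2"
  shows "2 * (1 - 2 * y) \<le> logit y"
proof -
  define g where "g y = logit y - 2 * (1 - 2 * y)" for y
  have "g (1/2) \<le> g y"
  proof (rule DERIV_nonpos_imp_nonincreasing[where f = g])
    fix x assume x: "y \<le> x" "x \<le> 1/2"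
    have "x * (1 - x) \<le> 1/4" using zero_le_power2[of "1 - 2 * x"] by (simp add: power2_eq_square algebra_simps)
    moreover have "0 < x * (1 - x)" using x assms by simp
    ultimately have "4 \<le> 1 / (x * (1 - x))" by (simp add: field_simps)
    moreover have "(g has_real_derivative - (1 / (x * (1 - x))) + 4) (at x)"
      unfolding g_def using x assms by (auto intro!: derivative_eq_intros has_derivative_logit)
    ultimately show "\<exists>D. (g has_real_derivative D) (at x) \<and> D \<le> 0"
      by (intro exI[of _ "- (1 / (x * (1 - x))) + 4"]) simp
  qed (use assms in simp)
  then show ?thesis by (simp add: g_def logit_def)
qed

lemma logit_pos: "0 < y \<Longrightarrow> y < 1/2 \<Longrightarrow> 0 < logit y"
  using logit_lower_bound[of y] by simp

text \<open>The sign of the derivative is that of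
  \<open>logit z * (1 - 2 * z + 2 * z^2) - (1 - 2 * z)\<close>. The linear lower bound on
  \<open>logit\<close> and \<open>1 - 2 * z + 2 * z^2 \<ge> 1/2\<close> make it nonnegative.\<close>

lemma logit_ratio_mono:
  assumes "0 < x" "x \<le> y" "y < 1/2"
  shows "logit x * (x * (1 - x)) / (1 - 2 * x) \<le> logit y * (y * (1 - y)) / (1 - 2 * y)"
proof (rule DERIV_nonneg_imp_nondecreasing[OF assms(2)])
  fix z assume z: "x \<le> z" "z \<le> y"
  then have z': "0 < z" "z < 1/2" using assms by auto
  let ?D = "(- 1 + logit z * (1 - 2 * z)) * (1 - 2 * z) - logit z * (z * (1 - z)) * (- 2)"
  have "((\<lambda>x. x * (1 - x)) has_real_derivative (1 - 2 * z)) (at z)"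
    by (auto intro!: derivative_eq_intros)
  from DERIV_mult[OF has_derivative_logit this]
  have f: "((\<lambda>x. logit x * (x * (1 - x))) has_real_derivative (- 1 + logit z * (1 - 2 * z))) (at z)"
    using z' by (simp add: mult.commute)
  have g: "((\<lambda>x. 1 - 2 * x) has_real_derivative (- 2)) (at z)"
    by (auto intro!: derivative_eq_intros)
  have D: "((\<lambda>x. logit x * (x * (1 - x)) / (1 - 2 * x)) has_real_derivative
      ?D / ((1 - 2 * z) * (1 - 2 * z))) (at z)"
    using z' by (intro DERIV_divide f g) auto
  have "?D = logit z * (1 - 2 * z + 2 * z^2) - (1 - 2 * z)"
    using z' by (simp add: field_simps power2_eq_square)
  moreover have "1/2 \<le> 1 - 2 * z + 2 * z^2"
    using zero_le_power2[of "1 - 2 * z"] by (simp add: power2_eq_square algebra_simps)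
  then have "2 * (1 - 2 * z) * (1/2) \<le> logit z * (1 - 2 * z + 2 * z^2)"
    using logit_lower_bound[OF z'] z' by (intro mult_mono) auto
  ultimately have "0 \<le> ?D" by simp
  then have "0 \<le> ?D / ((1 - 2 * z) * (1 - 2 * z))" by (intro divide_nonneg_nonneg) auto
  with D show "\<exists>D. ((\<lambda>x. logit x * (x * (1 - x)) / (1 - 2 * x)) has_real_derivative D) (at z) \<and> 0 \<le> D"
    by blast
qed

lemma noisy_bias_bounds:
  assumes "0 < x" "x < 1/2" "0 < \<tau>" "\<tau> < 1/2"
  shows "x \<le> noisy_bias x \<tau>" "noisy_bias x \<tau> < 1/2"
proof -
  have "noisy_bias x \<tau> = x + \<tau> * (1 - 2 * x)"
    by (simp add: noisy_bias_def algebra_simps)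
  then show "x \<le> noisy_bias x \<tau>" using assms by simp
  have "2 * noisy_bias x \<tau> = 1 - (1 - 2 * x) * (1 - 2 * \<tau>)"
    by (simp add: noisy_bias_def algebra_simps)
  moreover have "0 < (1 - 2 * x) * (1 - 2 * \<tau>)" using assms by simp
  ultimately show "noisy_bias x \<tau> < 1/2" by simp
qed

lemma noisy_bias_unit:
  assumes "0 < x" "x < 1" "0 < \<tau>" "\<tau> < 1"
  shows "0 < noisy_bias x \<tau>" "noisy_bias x \<tau> < 1"
proof -
  have "noisy_bias x \<tau> = x * (1 - \<tau>) + \<tau> * (1 - x)" "1 - noisy_bias x \<tau> = (1 - x) * (1 - \<tau>) + x * \<tau>"
    by (simp_all add: noisy_bias_def algebra_simps)
  moreover have "0 < x * (1 - \<tau>)" "0 < \<tau> * (1 - x)" "0 < (1 - x) * (1 - \<tau>)" "0 < x * \<tau>" using assms by auto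
  ultimately show "0 < noisy_bias x \<tau>" "noisy_bias x \<tau> < 1" by linarith+
qed

text \<open>Up to the factor \<open>1 - 2 * \<tau>\<close> the quotient is the derivative of
  \<open>H (N x \<tau>)\<close> with respect to \<open>H x\<close>, so this is the convexity of the
  curve. Its derivative is nonnegative by the preceding monotonicity, used between \<open>z\<close>
  and the larger point \<open>noisy_bias z \<tau>\<close>.\<close>

lemma logit_quotient_mono:
  assumes "0 < x" "x \<le> y" "y < 1/2" "0 < \<tau>" "\<tau> < 1/2"
  shows "logit (noisy_bias x \<tau>) / logit x \<le> logit (noisy_bias y \<tau>) / logit y"
proof (rule DERIV_nonneg_imp_nondecreasing[OF assms(2)])
  fix z assume z: "x \<le> z" "z \<le> y"
  then have z': "0 < z" "z < 1/2" using assms by auto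
  let ?n = "noisy_bias z \<tau>"
  have n: "0 < ?n" "?n < 1/2" "z \<le> ?n" using noisy_bias_bounds[OF z' assms(4,5)] z' by auto
  have "((\<lambda>x. noisy_bias x \<tau>) has_real_derivative (1 - 2 * \<tau>)) (at z)"
    unfolding noisy_bias_def by (auto intro!: derivative_eq_intros)
  from DERIV_chain2[OF has_derivative_logit[of ?n] this]
  have "((\<lambda>x. logit (noisy_bias x \<tau>)) has_real_derivative - (1 / (?n * (1 - ?n))) * (1 - 2 * \<tau>)) (at z)"
    using n by auto
  from DERIV_divide[OF this has_derivative_logit[of z]]
  have D: "((\<lambda>x. logit (noisy_bias x \<tau>) / logit x) has_real_derivative
    ((- (1 / (?n * (1 - ?n))) * (1 - 2 * \<tau>)) * logit z - logit ?n * (- (1 / (z * (1 - z))))) / (logit z * logit z)) (at z)"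
    using z' logit_pos[OF z'] by auto
  have pos: "0 < ?n * (1 - ?n)" "0 < z * (1 - z)" using n z' by auto
  \<comment> \<open>Bias multiplies under noise, which lets the factor \<open>1 - 2 * z\<close>
    cancel on both sides.\<close>
  have "1 - 2 * ?n = (1 - 2 * z) * (1 - 2 * \<tau>)" by (simp add: noisy_bias_def algebra_simps)
  moreover have "logit z * (z * (1 - z)) / (1 - 2 * z) \<le> logit ?n * (?n * (1 - ?n)) / (1 - 2 * ?n)"
    by (rule logit_ratio_mono) (use z' n in auto)
  ultimately have le: "logit z * (z * (1 - z)) / (1 - 2 * z)
      \<le> logit ?n * (?n * (1 - ?n)) / ((1 - 2 * z) * (1 - 2 * \<tau>))" by simp
  have clear: "A * l \<le> B" if "A / d \<le> B / (d * l)" "0 < d" "0 < l" for A B d l :: real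
    using that by (simp add: field_simps)
  have "logit z * (z * (1 - z)) * (1 - 2 * \<tau>) \<le> logit ?n * (?n * (1 - ?n))"
    by (rule clear[OF le]) (use z' assms(4,5) in auto)
  moreover have "(1 / c * l) * a \<le> b * (1 / e)" if "a * e * l \<le> b * c" "0 < c" "0 < e" for a b c e l :: real
    using that by (simp add: field_simps)
  ultimately have "(1 / (?n * (1 - ?n)) * (1 - 2 * \<tau>)) * logit z \<le> logit ?n * (1 / (z * (1 - z)))"
    using pos by blast
  then have "0 \<le> ((- (1 / (?n * (1 - ?n))) * (1 - 2 * \<tau>)) * logit z - logit ?n * (- (1 / (z * (1 - z))))) / (logit z * logit z)"
    using logit_pos[OF z'] by (intro divide_nonneg_nonneg) auto
  with D show "\<exists>D. ((\<lambda>x. logit (noisy_bias x \<tau>) / logit x) has_real_derivative D) (at z) \<and> 0 \<le> D" by blast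
qed

text \<open>The derivative of \<open>H (N p \<tau>)\<close> with respect to \<open>H p\<close>.\<close>

definition slope :: "real \<Rightarrow> real \<Rightarrow> real" where
  "slope p \<tau> = (1 - 2 * \<tau>) * (logit (noisy_bias p \<tau>) / logit p)"

lemma slope_pos:
  assumes "0 < p" "p < 1/2" "0 < \<tau>" "\<tau> < 1/2"
  shows "0 < slope p \<tau>"
  unfolding slope_def using assms noisy_bias_bounds[OF assms]
  by (intro mult_pos_pos divide_pos_pos logit_pos) auto

text \<open>On \<open>(0, 1/2)\<close> the derivative is
  \<open>logit z * (1 - slope z \<tau> / s)\<close>. By monotonicity of the slope it changes sign
  from plus to minus at \<open>p\<close>; the symmetry \<open>x \<mapsto> 1 - x\<close> covers the
  other half.\<close>

lemma entropy_gap_le: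
  assumes p: "0 < p" "p < 1/2" and t: "0 < \<tau>" "\<tau> < 1/2" and x: "0 < x" "x < 1"
  defines "s \<equiv> slope p \<tau>"
  shows "nat_entropy x - nat_entropy (noisy_bias x \<tau>) / s
    \<le> nat_entropy p - nat_entropy (noisy_bias p \<tau>) / s"
proof -
  define \<phi> where "\<phi> x = nat_entropy x - nat_entropy (noisy_bias x \<tau>) / s" for x
  have s: "0 < s" unfolding s_def using slope_pos p t by auto
  have D: "(\<phi> has_real_derivative logit z - logit (noisy_bias z \<tau>) * (1 - 2 * \<tau>) / s) (at z)"
    if "0 < z" "z < 1" for z
  proof -
    have "((\<lambda>x. noisy_bias x \<tau>) has_real_derivative (1 - 2 * \<tau>)) (at z)"
      unfolding noisy_bias_def by (auto intro!: derivative_eq_intros)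
    from DERIV_chain2[OF has_derivative_nat_entropy this] show ?thesis
      unfolding \<phi>_def using that noisy_bias_unit[OF that, of \<tau>] t has_derivative_nat_entropy[OF that] s
      by (auto intro!: derivative_eq_intros)
  qed
  have half: "logit (1/2) = 0" "noisy_bias (1/2) \<tau> = 1/2"
    by (simp_all add: logit_def noisy_bias_def field_simps)
  have D_eq: "logit z - logit (noisy_bias z \<tau>) * (1 - 2 * \<tau>) / s
      = logit z * (1 - (1 - 2 * \<tau>) * (logit (noisy_bias z \<tau>) / logit z) / s)" if "0 < z" "z < 1/2" for z
    using logit_pos[OF that] s by (simp add: field_simps)
  have main: "\<phi> y \<le> \<phi> p" if y: "0 < y" "y \<le> 1/2" for y
  proof (cases "y \<le> p")
    case True
    then show ?thesis
    proof (rule DERIV_nonneg_imp_nondecreasing)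
      fix z assume z: "y \<le> z" "z \<le> p"
      then have z': "0 < z" "z < 1/2" using y p by auto
      have "(1 - 2 * \<tau>) * (logit (noisy_bias z \<tau>) / logit z) \<le> s"
        unfolding s_def slope_def
        by (rule mult_left_mono[OF logit_quotient_mono]) (use z z' p t in auto)
      then have "0 \<le> logit z * (1 - (1 - 2 * \<tau>) * (logit (noisy_bias z \<tau>) / logit z) / s)"
        using logit_pos[OF z'] s by (intro mult_nonneg_nonneg) (auto simp: field_simps)
      then show "\<exists>D. (\<phi> has_real_derivative D) (at z) \<and> 0 \<le> D"
        using D[of z] D_eq[OF z'] z' by auto
    qed
  next
    case False
    then have "p \<le> y" by simp
    then show ?thesis
    proof (rule DERIV_nonpos_imp_nonincreasing)
      fix z assume z: "p \<le> z" "z \<le> y"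
      show "\<exists>D. (\<phi> has_real_derivative D) (at z) \<and> D \<le> 0"
      \<comment> \<open>The factored form divides by \<open>logit z\<close>, which vanishes at 1/2;
        there the derivative is simply 0.\<close>
      proof (cases "z = 1/2")
        case True
        show ?thesis unfolding True by (rule exI[of _ 0]) (use D[of "1/2"] half in simp)
      next
        case False
        then have z': "0 < z" "z < 1/2" using z y p by auto
        have "s \<le> (1 - 2 * \<tau>) * (logit (noisy_bias z \<tau>) / logit z)"
          unfolding s_def slope_def
          by (rule mult_left_mono[OF logit_quotient_mono]) (use z z' p t in auto)
        then have "logit z * (1 - (1 - 2 * \<tau>) * (logit (noisy_bias z \<tau>) / logit z) / s) \<le> 0"
          using logit_pos[OF z'] s by (intro mult_nonneg_nonpos) (auto simp: field_simps)
        then show ?thesis using D[of z] D_eq[OF z'] z' by auto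
      qed
    qed
  qed
  have "\<phi> x \<le> \<phi> p"
  proof (cases "x \<le> 1/2")
    case False
    have "nat_entropy (1 - y) = nat_entropy y" for y by (simp add: nat_entropy_def left_diff_distrib)
    moreover have "noisy_bias (1 - x) \<tau> = 1 - noisy_bias x \<tau>" by (simp add: noisy_bias_def algebra_simps)
    ultimately have "\<phi> x = \<phi> (1 - x)" by (simp add: \<phi>_def)
    then show ?thesis using main[of "1 - x"] x False by simp
  qed (use main x in auto)
  then show ?thesis by (simp add: \<phi>_def)
qed

section \<open>Gibbs' inequality and geometric means\<close>

lemma gibbs:
  assumes "0 < x" "x < 1" "0 < u" "u < 1"
  shows "x * ln u + (1 - x) * ln (1 - u) \<le> - nat_entropy x"
proof -
  have *: "ln a - ln b \<le> a / b - 1" if "0 < a" "0 < b" for a b :: real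
    using ln_le_minus_one[of "a / b"] that by (simp add: ln_div)
  have "x * (ln u - ln x) + (1 - x) * (ln (1 - u) - ln (1 - x)) \<le> x * (u / x - 1) + (1 - x) * ((1 - u) / (1 - x) - 1)"
    using assms by (intro add_mono mult_left_mono *) auto
  also have "\<dots> = 0" using assms by (simp add: field_simps)
  finally show ?thesis by (simp add: nat_entropy_def algebra_simps)
qed

text \<open>The weight \<open>x\<close> attains the supremum in the Gibbs variational principle.\<close>

lemma ln_add_eq_entropy:
  assumes "0 < A" "0 < B"
  defines "x \<equiv> A / (A + B)"
  shows "ln (A + B) = nat_entropy x + x * ln A + (1 - x) * ln (B::real)"
proof -
  have "1 - x = B / (A + B)" "0 < A + B" using assms by (auto simp: x_def field_simps)
  then have "ln x = ln A - ln (A + B)" "ln (1 - x) = ln B - ln (A + B)"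
    using assms(1,2) by (simp_all add: x_def ln_div del: diff_divide_distrib)
  then have "nat_entropy x = - x * (ln A - ln (A + B)) - (1 - x) * (ln B - ln (A + B))"
    by (simp only: nat_entropy_def)
  then show ?thesis by (simp add: algebra_simps)
qed

text \<open>The limit of the two-point inequality as \<open>q\<close> tends to infinity, normalized
  to \<open>u + v = 1\<close>. With \<open>x\<close> the Gibbs weight of the two terms, the
  exponents combine into a cross entropy between \<open>noisy_bias x \<tau>\<close> and
  \<open>u\<close>; Gibbs' inequality eliminates \<open>u\<close>, and the entropy gap is largest at
  \<open>p\<close>.\<close>

lemma geometric_mean_bound:
  assumes p: "0 < p" "p < 1/2" and t: "0 < \<tau>" "\<tau> < 1/2" and u: "0 < u" "u < 1"
  defines "s \<equiv> slope p \<tau>"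
  shows "exp (((1 - \<tau>) * ln u + \<tau> * ln (1 - u)) / s) + exp ((\<tau> * ln u + (1 - \<tau>) * ln (1 - u)) / s)
    \<le> exp (nat_entropy p - nat_entropy (noisy_bias p \<tau>) / s)"
proof -
  define A B where "A = exp (((1 - \<tau>) * ln u + \<tau> * ln (1 - u)) / s)"
    and "B = exp ((\<tau> * ln u + (1 - \<tau>) * ln (1 - u)) / s)"
  have AB: "0 < A" "0 < B" by (auto simp: A_def B_def)
  have s: "0 < s" unfolding s_def using slope_pos p t by auto
  define x where "x = A / (A + B)"
  have x: "0 < x" "x < 1" using AB by (auto simp: x_def)
  have nx: "0 < noisy_bias x \<tau>" "noisy_bias x \<tau> < 1" using noisy_bias_unit x t by auto
  have "ln (A + B) = nat_entropy x + x * ln A + (1 - x) * ln B"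
    unfolding x_def by (rule ln_add_eq_entropy[OF AB])
  also have "\<dots> = nat_entropy x + (noisy_bias x \<tau> * ln u + (1 - noisy_bias x \<tau>) * ln (1 - u)) / s"
    using s by (simp add: A_def B_def noisy_bias_def field_simps)
  also have "\<dots> \<le> nat_entropy x + (- nat_entropy (noisy_bias x \<tau>)) / s"
    using gibbs[OF nx u] s by (intro add_left_mono divide_right_mono) auto
  also have "\<dots> \<le> nat_entropy p - nat_entropy (noisy_bias p \<tau>) / s"
    using entropy_gap_le[OF p t x] by (simp add: s_def)
  finally have "A + B \<le> exp (nat_entropy p - nat_entropy (noisy_bias p \<tau>) / s)"
    using AB by (metis add_pos_pos exp_le_cancel_iff exp_ln)
  then show ?thesis by (simp only: A_def B_def)
qed

section \<open>Power means with small exponents\<close>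

lemma exp_minus_le_quadratic:
  fixes y :: real assumes "0 \<le> y" shows "exp (- y) \<le> 1 - y + y\<^sup>2"
proof -
  \<comment> \<open>The product equals \<open>1 + y^3\<close>.\<close>
  have "1 \<le> (1 - y + y\<^sup>2) * (1 + y)" using assms by (simp add: algebra_simps power2_eq_square)
  also have "\<dots> \<le> (1 - y + y\<^sup>2) * exp y"
  proof (intro mult_left_mono)
    have "1 - y + y\<^sup>2 = (1 - y / 2)\<^sup>2 + 3 / 4 * y\<^sup>2"
      by (simp add: power2_eq_square algebra_simps)
    then show "0 \<le> 1 - y + y\<^sup>2" by simp
  qed simp
  finally show ?thesis by (simp add: exp_minus field_simps)
qed

text \<open>For \<open>-K \<le> ln w \<le> 0\<close> the expansion
  \<open>w powr \<epsilon> = 1 + \<epsilon> * ln w + ...\<close> errs upwards by at most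
  \<open>(\<epsilon> * K)^2\<close>. The \<open>q\<close>-th power multiplies the exponents by
  \<open>q\<close>, so the total error \<open>K^2 / (s^2 * q)\<close> vanishes as \<open>q\<close>
  grows.\<close>

lemma power_mean_bound:
  fixes q :: nat
  assumes "exp (- K) \<le> u" "u \<le> 1" "exp (- K) \<le> v" "v \<le> 1" "0 \<le> t" "t \<le> 1" "0 < s" "0 < q"
  defines "\<epsilon> \<equiv> 1 / (s * real q)"
  shows "((1 - t) * u powr \<epsilon> + t * v powr \<epsilon>) ^ q
    \<le> exp (((1 - t) * ln u + t * ln v) / s) * exp (K\<^sup>2 / (s\<^sup>2 * real q))"
proof -
  have e: "0 < \<epsilon>" using assms by (simp add: \<epsilon>_def)
  have *: "w powr \<epsilon> \<le> 1 + \<epsilon> * ln w + (\<epsilon> * K)\<^sup>2" if w: "exp (- K) \<le> w" "w \<le> 1" for w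
  proof -
    have "0 < w" using w(1) exp_gt_zero less_le_trans by blast
    then have l: "- K \<le> ln w" "ln w \<le> 0" using w by (auto simp: ln_ge_iff)
    have "w powr \<epsilon> = exp (- (\<epsilon> * - ln w))" using \<open>0 < w\<close> by (simp add: powr_def)
    also have "\<dots> \<le> 1 - \<epsilon> * - ln w + (\<epsilon> * - ln w)\<^sup>2"
      by (intro exp_minus_le_quadratic mult_nonneg_nonneg) (use e l in auto)
    also have "(\<epsilon> * - ln w)\<^sup>2 \<le> (\<epsilon> * K)\<^sup>2"
      using e l by (intro power_mono mult_left_mono mult_nonneg_nonneg) auto
    finally show ?thesis by simp
  qed
  have uv: "0 < u" "0 < v" using assms exp_gt_zero less_le_trans by blast+
  let ?m = "(1 - t) * ln u + t * ln v"
  have "(1 - t) * u powr \<epsilon> + t * v powr \<epsilon>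
      \<le> (1 - t) * (1 + \<epsilon> * ln u + (\<epsilon> * K)\<^sup>2) + t * (1 + \<epsilon> * ln v + (\<epsilon> * K)\<^sup>2)"
    using assms by (intro add_mono mult_left_mono *) auto
  also have "\<dots> = 1 + (\<epsilon> * ?m + (\<epsilon> * K)\<^sup>2)" by (simp add: algebra_simps)
  also have "\<dots> \<le> exp (\<epsilon> * ?m + (\<epsilon> * K)\<^sup>2)" by (rule exp_ge_add_one_self)
  finally have "((1 - t) * u powr \<epsilon> + t * v powr \<epsilon>) ^ q \<le> exp (\<epsilon> * ?m + (\<epsilon> * K)\<^sup>2) ^ q"
    using assms by (intro power_mono add_nonneg_nonneg mult_nonneg_nonneg) auto
  also have "\<dots> = exp (real q * (\<epsilon> * ?m + (\<epsilon> * K)\<^sup>2))" by (simp add: exp_of_nat_mult)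
  also have "real q * (\<epsilon> * ?m + (\<epsilon> * K)\<^sup>2) = ?m / s + K\<^sup>2 / (s\<^sup>2 * real q)"
  proof -
    have "real q * \<epsilon> = 1 / s" "real q * \<epsilon>\<^sup>2 = 1 / (s\<^sup>2 * real q)"
      using assms by (simp_all add: \<epsilon>_def field_simps power2_eq_square)
    then have "real q * \<epsilon> * ?m = ?m / s" "real q * \<epsilon>\<^sup>2 * K\<^sup>2 = K\<^sup>2 / (s\<^sup>2 * real q)" by simp_all
    then show ?thesis by (simp add: distrib_left power_mult_distrib mult.assoc)
  qed
  finally show ?thesis by (simp add: exp_add)
qed

text \<open>As \<open>q\<close> grows, the exponents \<open>1 / (s q)\<close> tend to \<open>0\<close> and the power means on the left become the
  geometric means of the preceding lemmas; uniformity in \<open>u\<close> and \<open>v\<close> fails only where one of them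
  is tiny compared to the other, and there both terms are small by monotonicity.\<close>

lemma two_point_inequality:
  assumes p: "0 < p" "p < 1/2" and t: "0 < \<tau>" "\<tau> < 1/2"
  defines "s \<equiv> slope p \<tau>"
  assumes M: "exp (nat_entropy p - nat_entropy (noisy_bias p \<tau>) / s) < M"
  shows "\<exists>q>0. \<forall>u\<ge>0. \<forall>v\<ge>0.
    ((1 - \<tau>) * u powr (1 / (s * real q)) + \<tau> * v powr (1 / (s * real q))) ^ q
    + (\<tau> * u powr (1 / (s * real q)) + (1 - \<tau>) * v powr (1 / (s * real q))) ^ q
    \<le> M * (u + v) powr (1 / s)"
proof -
  define M0 where "M0 = exp (nat_entropy p - nat_entropy (noisy_bias p \<tau>) / s)"
  have M0: "0 < M0" "M0 < M" using M by (auto simp: M0_def)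
  have s: "0 < s" unfolding s_def using slope_pos p t by auto
  \<comment> \<open>Chosen so that \<open>2 * exp (- (\<tau> * K / s)) \<le> M0\<close>: if one
    argument is below \<open>exp (- K)\<close>, both terms together stay below \<open>M0\<close> up
    to the error factor. The maximum with 1 keeps \<open>K\<close> positive.\<close>
  define K where "K = max 1 (s * (ln 2 - ln M0) / \<tau>)"
  have K: "0 < K" by (simp add: K_def)
  have "s * (ln 2 - ln M0) / \<tau> \<le> K" by (simp add: K_def)
  then have "ln 2 - ln M0 \<le> \<tau> * K / s" using s t by (simp add: field_simps)
  then have "exp (ln 2 - \<tau> * K / s) \<le> exp (ln M0)" by simp
  then have K2: "2 * exp (- (\<tau> * K / s)) \<le> M0" using M0 by (simp add: exp_diff exp_minus field_simps)
  have "(\<lambda>q. M0 * exp (K\<^sup>2 / (s\<^sup>2 * real q))) \<longlonglongrightarrow> M0 * exp 0"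
    using s by (intro tendsto_intros) real_asymp
  then have "eventually (\<lambda>q. M0 * exp (K\<^sup>2 / (s\<^sup>2 * real q)) < M) sequentially"
    using M0 by (intro order_tendstoD) auto
  then have "eventually (\<lambda>q. M0 * exp (K\<^sup>2 / (s\<^sup>2 * real q)) < M \<and> 0 < q) sequentially"
    using eventually_gt_at_top[of 0] by (rule eventually_conj)
  then obtain q :: nat where q: "0 < q" and M_q: "M0 * exp (K\<^sup>2 / (s\<^sup>2 * real q)) < M"
    by (auto simp: eventually_sequentially)
  define \<epsilon> where "\<epsilon> = 1 / (s * real q)"
  have e: "0 < \<epsilon>" using s q by (simp add: \<epsilon>_def)
  define E where "E = exp (K\<^sup>2 / (s\<^sup>2 * real q))"
  have E: "0 < E" by (simp add: E_def)
  define S where "S u v = ((1 - \<tau>) * u powr \<epsilon> + \<tau> * v powr \<epsilon>) ^ q + (\<tau> * u powr \<epsilon> + (1 - \<tau>) * v powr \<epsilon>) ^ q" for u v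
  have bound: "((1 - r) * u powr \<epsilon> + r * v powr \<epsilon>) ^ q \<le> exp (((1 - r) * ln u + r * ln v) / s) * E"
    if "exp (- K) \<le> u" "u \<le> 1" "exp (- K) \<le> v" "v \<le> 1" "0 \<le> r" "r \<le> 1" for u v r
    using power_mean_bound[OF that s q] by (simp add: \<epsilon>_def E_def)
  have small: "S u v \<le> M0 * E" if uv: "u + v = 1" "0 \<le> u" "u \<le> v" for u v
  proof (cases "exp (- K) \<le> u")
    case True
    then have u: "0 < u" "u < 1" "v = 1 - u" using uv exp_gt_zero less_le_trans[OF exp_gt_zero True] by auto
    have "S u v \<le> exp (((1 - \<tau>) * ln u + \<tau> * ln v) / s) * E + exp ((\<tau> * ln u + (1 - \<tau>) * ln v) / s) * E"
      unfolding S_def using bound[of u v \<tau>] bound[of u v "1 - \<tau>"] True uv u t by (intro add_mono) auto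
    also have "\<dots> \<le> M0 * E"
      using geometric_mean_bound[OF p t u(1,2)] E u(3) by (simp add: distrib_right[symmetric] M0_def s_def)
    finally show ?thesis .
  next
    case False
    let ?k = "exp (- K)"
    have mono: "((1 - r) * u powr \<epsilon> + r * v powr \<epsilon>) ^ q \<le> exp (- (\<tau> * K / s)) * E"
      if r: "r = \<tau> \<or> r = 1 - \<tau>" for r
    proof -
      have r01: "0 \<le> r" "r \<le> 1" "\<tau> \<le> 1 - r" using r t by auto
      have "((1 - r) * u powr \<epsilon> + r * v powr \<epsilon>) ^ q \<le> ((1 - r) * ?k powr \<epsilon> + r * 1 powr \<epsilon>) ^ q"
        using False uv r01 e by (intro power_mono add_mono mult_left_mono powr_mono2 add_nonneg_nonneg mult_nonneg_nonneg) auto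
      also have "\<dots> \<le> exp (((1 - r) * ln ?k + r * ln 1) / s) * E"
        by (rule bound) (use K r01 in auto)
      also have "\<dots> \<le> exp (- (\<tau> * K / s)) * E"
        using r01 K s E by (simp add: divide_right_mono mult_right_mono)
      finally show ?thesis .
    qed
    have "S u v \<le> exp (- (\<tau> * K / s)) * E + exp (- (\<tau> * K / s)) * E"
      unfolding S_def using mono[of \<tau>] mono[of "1 - \<tau>"] by (intro add_mono) auto
    also have "\<dots> = 2 * exp (- (\<tau> * K / s)) * E" by simp
    also have "\<dots> \<le> M0 * E" using K2 E by (intro mult_right_mono) auto
    finally show ?thesis .
  qed
  have S_sym: "S u v = S v u" for u v by (simp add: S_def add.commute)
  have unit: "S u v \<le> M" if "u + v = 1" "0 \<le> u" "0 \<le> v" for u v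
  proof -
    have "S u v \<le> M0 * E"
      using small[of u v] small[of v u] S_sym[of u v] that by (cases "u \<le> v") auto
    then show ?thesis using M_q by (simp add: E_def)
  qed
  \<comment> \<open>Both sides are homogeneous of degree \<open>1 / s\<close>, so the case of sum 1
    suffices. At the origin both sides vanish, since \<open>0 powr r = 0\<close>.\<close>
  have "S u v \<le> M * (u + v) powr (1 / s)" if uv: "0 \<le> u" "0 \<le> v" for u v
  proof (cases "u + v = 0")
    case True
    then have "u = 0" "v = 0" using uv by auto
    then show ?thesis using q by (simp add: S_def zero_power)
  next
    case False
    define w where "w = u + v"
    have w: "0 < w" using False uv by (simp add: w_def)
    have wq: "(w powr \<epsilon>) ^ q = w powr (1 / s)"
      using w q s by (simp add: powr_power \<epsilon>_def)
    have "S u v = S (w * (u / w)) (w * (v / w))" using w by simp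
    also have "\<dots> = (w powr \<epsilon> * ((1 - \<tau>) * (u / w) powr \<epsilon> + \<tau> * (v / w) powr \<epsilon>)) ^ q
        + (w powr \<epsilon> * (\<tau> * (u / w) powr \<epsilon> + (1 - \<tau>) * (v / w) powr \<epsilon>)) ^ q"
      unfolding S_def using w uv by (subst (1 2 3 4) powr_mult) (auto simp: algebra_simps)
    also have "\<dots> = w powr (1 / s) * S (u / w) (v / w)"
      by (simp only: power_mult_distrib wq S_def) (rule distrib_left[symmetric])
    also have "\<dots> \<le> w powr (1 / s) * M"
    proof (intro mult_left_mono unit)
      show "u / w + v / w = 1" using w by (simp add: w_def add_divide_distrib[symmetric])
    qed (use w uv in auto)
    finally show ?thesis by (simp add: w_def mult.commute)
  qed
  then show ?thesis using q by (auto simp: S_def \<epsilon>_def intro!: exI[of _ q])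
qed

section \<open>Counting by an operator norm bound\<close>

lemma hamming_Cons: "hamming (c # x) (d # y) = (if c = d then 0 else 1) + hamming x y"
  by (simp add: hamming_def sum.lessThan_Suc_shift del: sum.lessThan_Suc)

text \<open>Generic in the semiring: over the integers these are the weights in
  \<open>heavy\<close>; over the reals, \<open>a = \<tau>\<close> and \<open>b = 1 - \<tau>\<close>
  give the probability that the noise turns \<open>x\<close> into \<open>y\<close>.\<close>

definition noise_weight :: "'a::comm_semiring_1 \<Rightarrow> 'a \<Rightarrow> bool list \<Rightarrow> bool list \<Rightarrow> 'a" where
  "noise_weight a b x y = a ^ hamming x y * b ^ (length x - hamming x y)"

lemma noise_weight_Nil: "noise_weight a b [] y = 1"
  by (simp add: noise_weight_def hamming_def)

lemma noise_weight_Cons: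
  "noise_weight a b (c # x) (d # y) = (if c = d then b else a) * noise_weight a b x y"
proof -
  have "Suc (length x) - hamming x y = Suc (length x - hamming x y)"
    using hamming_le by (rule Suc_diff_le)
  then show ?thesis by (simp add: noise_weight_def hamming_Cons mult_ac)
qed

lemma power_convex_combination:
  fixes x y t :: real
  assumes "0 \<le> x" "0 \<le> y" "0 \<le> t" "t \<le> 1"
  shows "((1 - t) * x + t * y) ^ q \<le> (1 - t) * x ^ q + t * y ^ q"
proof -
  have "convex_on {0..} (\<lambda>x::real. x ^ q)"
  proof (cases "even q")
    case True
    then show ?thesis by (intro convex_on_subset[OF convex_power_even]) auto
  qed (rule convex_power_odd)
  from convex_onD[OF this, of t x y] assms show ?thesis by simp
qed

text \<open>Minkowski's inequality with \<open>A\<close> and \<open>B\<close> as bounds for the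
  norms, which avoids roots. Convexity of the power is applied to \<open>g x / A\<close> and
  \<open>h x / B\<close> with weights proportional to \<open>A\<close> and \<open>B\<close>; a bound
  that is zero forces its function to vanish.\<close>

lemma minkowski_two:
  fixes g h :: "'a \<Rightarrow> real"
  assumes fin: "finite S" and g: "\<And>x. x \<in> S \<Longrightarrow> 0 \<le> g x" and h: "\<And>x. x \<in> S \<Longrightarrow> 0 \<le> h x"
    and A: "0 \<le> A" "(\<Sum>x\<in>S. g x ^ q) \<le> A ^ q" and B: "0 \<le> B" "(\<Sum>x\<in>S. h x ^ q) \<le> B ^ q"
    and q: "0 < q"
  shows "(\<Sum>x\<in>S. (g x + h x) ^ q) \<le> (A + B) ^ q"
proof -
  have zero: "f x = 0" if "(\<Sum>x\<in>S. f x ^ q) \<le> 0" "\<And>x. x \<in> S \<Longrightarrow> 0 \<le> f x" "x \<in> S"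
    for f :: "'a \<Rightarrow> real" and x
  proof -
    have "f x ^ q \<le> (\<Sum>x\<in>S. f x ^ q)" using that fin by (intro member_le_sum) auto
    then have "f x ^ q \<le> 0" using that(1) by simp
    then show ?thesis using that(2,3) q by (metis antisym zero_le_power power_eq_0_iff)
  qed
  consider "A = 0" | "B = 0" | "0 < A" "0 < B" using A B by linarith
  then show ?thesis
  proof cases
    case 1
    then have "g x = 0" if "x \<in> S" for x using zero[of g x] A q g that by (simp add: zero_power)
    then show ?thesis using B 1 by simp
  next
    case 2
    then have "h x = 0" if "x \<in> S" for x using zero[of h x] B q h that by (simp add: zero_power)
    then show ?thesis using A 2 by simp
  next
    case 3
    define t where "t = B / (A + B)"
    have t: "0 \<le> t" "t \<le> 1" "1 - t = A / (A + B)" using 3 by (auto simp: t_def field_simps)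
    have "(g x + h x) ^ q \<le> (A + B) ^ q * ((1 - t) * (g x ^ q / A ^ q) + t * (h x ^ q / B ^ q))"
      if x: "x \<in> S" for x
    proof -
      have "g x + h x = (A + B) * ((1 - t) * (g x / A) + t * (h x / B))"
      proof -
        have "(A + B) * (1 - t) = A" "(A + B) * t = B" using 3 unfolding t(3) by (auto simp: t_def)
        then have "(A + B) * (1 - t) * (g x / A) = g x" "(A + B) * t * (h x / B) = h x" using 3 by simp_all
        then show ?thesis by (simp only: distrib_left mult.assoc)
      qed
      moreover have "((1 - t) * (g x / A) + t * (h x / B)) ^ q
          \<le> (1 - t) * (g x / A) ^ q + t * (h x / B) ^ q"
        using 3 g h x t by (intro power_convex_combination) auto
      ultimately show ?thesis
        using 3 by (simp add: power_mult_distrib power_divide)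
    qed
    then have "(\<Sum>x\<in>S. (g x + h x) ^ q)
        \<le> (\<Sum>x\<in>S. (A + B) ^ q * ((1 - t) * (g x ^ q / A ^ q) + t * (h x ^ q / B ^ q)))"
      by (rule sum_mono)
    also have "\<dots> = (A + B) ^ q * ((1 - t) * ((\<Sum>x\<in>S. g x ^ q) / A ^ q) + t * ((\<Sum>x\<in>S. h x ^ q) / B ^ q))"
      by (simp only: sum_distrib_left[symmetric] sum_divide_distrib[symmetric] sum.distrib)
    also have "\<dots> \<le> (A + B) ^ q * ((1 - t) * 1 + t * 1)"
      using 3 A B t(1,2) by (intro mult_left_mono add_mono) auto
    finally show ?thesis by simp
  qed
qed

lemma sum_split_Cons:
  fixes B :: "bool list set"
  assumes "finite B" "[] \<notin> B"
  shows "(\<Sum>y\<in>B. f y) = (\<Sum>y\<in>{y. False # y \<in> B}. f (False # y)) + (\<Sum>y\<in>{y. True # y \<in> B}. f (True # y))"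
proof -
  have B: "B = Cons False ` {y. False # y \<in> B} \<union> Cons True ` {y. True # y \<in> B}" (is "_ = ?F \<union> ?T")
  proof (intro set_eqI iffI)
    fix y assume "y \<in> B"
    then show "y \<in> ?F \<union> ?T" using assms(2) by (cases y; cases "hd y") auto
  qed auto
  have "finite (?F \<union> ?T)" using assms(1) B by simp
  then have "sum f (?F \<union> ?T) = sum f ?F + sum f ?T" by (intro sum.union_disjoint) auto
  moreover have "sum f ?F = (\<Sum>y\<in>{y. False # y \<in> B}. f (False # y))" "sum f ?T = (\<Sum>y\<in>{y. True # y \<in> B}. f (True # y))"
    by (subst sum.reindex; simp)+
  ultimately show ?thesis using B by simp
qed

text \<open>Induction on the length. Split \<open>B\<close> by first bit; for each first bit of
  \<open>x\<close> the inner sum is a convex combination of the two functions belonging to the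
  halves, and Minkowski bounds its norm by the same combination of their norms. What remains is the
  single-bit inequality for the sizes of the halves.\<close>

lemma noise_norm_bound:
  fixes M s \<tau> :: real and q :: nat
  assumes ineq: "\<And>u v. 0 \<le> u \<Longrightarrow> 0 \<le> v \<Longrightarrow>
    ((1 - \<tau>) * u powr (1 / (s * real q)) + \<tau> * v powr (1 / (s * real q))) ^ q
    + (\<tau> * u powr (1 / (s * real q)) + (1 - \<tau>) * v powr (1 / (s * real q))) ^ q
    \<le> M * (u + v) powr (1 / s)"
    and q: "0 < q" and s: "0 < s" and t: "0 \<le> \<tau>" "\<tau> \<le> 1" and M: "0 \<le> M"
    and B: "B \<subseteq> {y. length y = n}"
  shows "(\<Sum>x\<in>{x. length x = n}. (\<Sum>y\<in>B. noise_weight \<tau> (1 - \<tau>) x y) ^ q)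
    \<le> M ^ n * real (card B) powr (1 / s)"
  using B
proof (induction n arbitrary: B)
  case 0
  then have "B = {} \<or> B = {[]}" by auto
  moreover have "{x :: bool list. length x = 0} = {[]}" by auto
  ultimately show ?case using q by (auto simp: noise_weight_Nil zero_power)
next
  case (Suc n)
  define \<epsilon> where "\<epsilon> = 1 / (s * real q)"
  define Bc where "Bc c = {y. c # y \<in> B}" for c
  have Bc: "Bc c \<subseteq> {y. length y = n}" for c using Suc.prems by (auto simp: Bc_def)
  have finB: "finite B" by (rule finite_subset[OF Suc.prems finite_length])
  have B0: "[] \<notin> B" using Suc.prems by auto
  define g where "g c x = (\<Sum>y\<in>Bc c. noise_weight \<tau> (1 - \<tau>) x y)" for c x
  have g0: "0 \<le> g c x" for c x
    unfolding g_def noise_weight_def using t by (intro sum_nonneg) auto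
  \<comment> \<open>The \<open>q\<close>-th root of the bound that the induction hypothesis gives
    for the half with first bit \<open>c\<close>.\<close>
  define A where "A c = root q (M ^ n) * real (card (Bc c)) powr \<epsilon>" for c
  have A0: "0 \<le> A c" for c using M q by (simp add: A_def)
  have root: "root q (M ^ n) ^ q = M ^ n" using q M by (simp add: real_root_pow_pos2)
  have pow: "(real (card (Bc c)) powr \<epsilon>) ^ q = real (card (Bc c)) powr (1 / s)" for c
  proof (cases "card (Bc c) = 0")
    case False
    then show ?thesis using q s by (simp add: powr_power \<epsilon>_def)
  qed (simp add: zero_power q)
  have IH: "(\<Sum>x\<in>{x. length x = n}. g c x ^ q) \<le> A c ^ q" for c
    using Suc.IH[OF Bc] by (simp add: g_def A_def power_mult_distrib root pow)
  have step: "(\<Sum>x\<in>{x. length x = n}. (\<Sum>y\<in>B. noise_weight \<tau> (1 - \<tau>) (c # x) y) ^ q)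
      \<le> ((if c then \<tau> else 1 - \<tau>) * A False + (if c then 1 - \<tau> else \<tau>) * A True) ^ q" for c
  proof -
    have "(\<Sum>y\<in>B. noise_weight \<tau> (1 - \<tau>) (c # x) y)
        = (if c then \<tau> else 1 - \<tau>) * g False x + (if c then 1 - \<tau> else \<tau>) * g True x" for x
      unfolding sum_split_Cons[OF finB B0] noise_weight_Cons g_def Bc_def by (simp add: sum_distrib_left)
    moreover have "(\<Sum>x\<in>{x. length x = n}. (r * g False x + r' * g True x) ^ q) \<le> (r * A False + r' * A True) ^ q"
      if "0 \<le> r" "0 \<le> r'" for r r'
    proof (rule minkowski_two[OF finite_length _ _ _ _ _ _ q])
      have "(\<Sum>x\<in>{x. length x = n}. (w * g c x) ^ q) \<le> (w * A c) ^ q" if "0 \<le> w" for w c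
        using IH[of c] that by (simp add: power_mult_distrib sum_distrib_left[symmetric] mult_left_mono)
      then show "(\<Sum>x\<in>{x. length x = n}. (r * g False x) ^ q) \<le> (r * A False) ^ q"
        "(\<Sum>x\<in>{x. length x = n}. (r' * g True x) ^ q) \<le> (r' * A True) ^ q"
        using that by auto
    qed (use that g0 A0 in auto)
    ultimately show ?thesis using t by simp
  qed
  let ?f = "\<lambda>x. (\<Sum>y\<in>B. noise_weight \<tau> (1 - \<tau>) x y) ^ q"
  have "(\<Sum>x\<in>{x. length x = Suc n}. ?f x)
      = (\<Sum>x\<in>{x. length x = n}. ?f (False # x)) + (\<Sum>x\<in>{x. length x = n}. ?f (True # x))"
    using sum_split_Cons[OF finite_length[of "Suc n"], of ?f] by simp
  also have "\<dots> \<le> ((1 - \<tau>) * A False + \<tau> * A True) ^ q + (\<tau> * A False + (1 - \<tau>) * A True) ^ q"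
    using step[of False] step[of True] by simp
  also have "\<dots> = M ^ n * (((1 - \<tau>) * real (card (Bc False)) powr \<epsilon> + \<tau> * real (card (Bc True)) powr \<epsilon>) ^ q
      + (\<tau> * real (card (Bc False)) powr \<epsilon> + (1 - \<tau>) * real (card (Bc True)) powr \<epsilon>) ^ q)"
  proof -
    have "(r * A False + r' * A True) ^ q = M ^ n * (r * real (card (Bc False)) powr \<epsilon> + r' * real (card (Bc True)) powr \<epsilon>) ^ q" for r r'
    proof -
      have "r * A False + r' * A True = root q (M ^ n) * (r * real (card (Bc False)) powr \<epsilon> + r' * real (card (Bc True)) powr \<epsilon>)"
        by (simp add: A_def algebra_simps)
      then show ?thesis by (simp only: power_mult_distrib root)
    qed
    then show ?thesis by (simp only: distrib_left)
  qed
  also have "\<dots> \<le> M ^ n * (M * (real (card (Bc False)) + real (card (Bc True))) powr (1 / s))"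
    using M by (intro mult_left_mono ineq[folded \<epsilon>_def]) auto
  also have "real (card (Bc False)) + real (card (Bc True)) = real (card B)"
    using sum_split_Cons[OF finB B0, of "\<lambda>_. 1 :: nat"] by (simp add: Bc_def)
  finally show ?case by (simp add: mult_ac)
qed

section \<open>Noise weights: products, scaling and probabilities\<close>

lemma noise_weight_conv_prod:
  "length x = length y \<Longrightarrow> noise_weight a b x y = (\<Prod>i<length x. if x ! i = y ! i then b else a)"
  by (induction x y rule: list_induct2)
    (simp_all add: noise_weight_Nil noise_weight_Cons prod.lessThan_Suc_shift del: prod.lessThan_Suc)

lemma noise_weight_mono:
  fixes a b a' b' :: real
  assumes "0 \<le> a" "a \<le> a'" "0 \<le> b" "b \<le> b'"
  shows "noise_weight a b x y \<le> noise_weight a' b' x y"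
  unfolding noise_weight_def using assms by (intro mult_mono power_mono) auto

lemma noise_weight_scale:
  "noise_weight (k * a) (k * b) x y = k ^ length x * noise_weight a b x y"
proof -
  have "k ^ length x = k ^ hamming x y * k ^ (length x - hamming x y)"
    using hamming_le[of x y] by (simp add: power_add[symmetric])
  then show ?thesis by (simp add: noise_weight_def power_mult_distrib mult_ac)
qed

lemma of_nat_noise_weight:
  "of_nat (noise_weight a b x y) = noise_weight (of_nat a) (of_nat b) x y"
  by (simp add: noise_weight_def)

lemma prob_noisy_prefix:
  assumes t: "0 \<le> \<tau>" "\<tau> \<le> 1" and B: "B \<subseteq> {y. length y = n}"
  shows "{F \<in> space (flips \<tau>). map (flip X F) [0..<n] \<in> B} \<in> sets (flips \<tau>)" (is ?meas)
    and "measure (flips \<tau>) {F \<in> space (flips \<tau>). map (flip X F) [0..<n] \<in> B}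
      = (\<Sum>y\<in>B. noise_weight \<tau> (1 - \<tau>) (map X [0..<n]) y)" (is ?prob)
proof -
  interpret product_prob_space "\<lambda>_::nat. measure_pmf (bernoulli_pmf \<tau>)" UNIV
    by unfold_locales
  \<comment> \<open>The noisy prefix equals \<open>y\<close> exactly when the flips occur where
    \<open>y\<close> and \<open>X\<close> differ. This is a cylinder, so its probability is a
    product; distinct \<open>y\<close> give disjoint cylinders.\<close>
  define E where "E y = {F \<in> space (flips \<tau>). \<forall>i\<in>{..<n}. F i \<in> {y ! i \<noteq> X i}}" for y
  have E_sets: "E y \<in> sets (flips \<tau>)" for y
    unfolding E_def flips_def by (intro sets.sets_Collect_finite_All sets_Collect_single') auto
  have mem_E: "F \<in> E y \<longleftrightarrow> F \<in> space (flips \<tau>) \<and> map (flip X F) [0..<n] = y" if "length y = n" for F y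
  proof -
    have "map (flip X F) [0..<n] = y \<longleftrightarrow> (\<forall>i<n. flip X F i = y ! i)"
      using that by (simp add: list_eq_iff_nth_eq)
    also have "\<dots> \<longleftrightarrow> (\<forall>i\<in>{..<n}. F i \<in> {y ! i \<noteq> X i})"
      unfolding flip_def by (intro iffI ballI allI impI) (auto split: if_splits)
    finally show ?thesis by (simp add: E_def)
  qed
  have eq: "{F \<in> space (flips \<tau>). map (flip X F) [0..<n] \<in> B} = (\<Union>y\<in>B. E y)"
  proof (intro set_eqI)
    fix F
    have "F \<in> (\<Union>y\<in>B. E y) \<longleftrightarrow> (\<exists>y\<in>B. F \<in> space (flips \<tau>) \<and> map (flip X F) [0..<n] = y)"
      unfolding UN_iff by (intro bex_cong refl mem_E) (use B in auto)
    then show "F \<in> {F \<in> space (flips \<tau>). map (flip X F) [0..<n] \<in> B} \<longleftrightarrow> F \<in> (\<Union>y\<in>B. E y)" by simp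
  qed
  have fin: "finite B" by (rule finite_subset[OF B finite_length])
  show ?meas unfolding eq using fin E_sets by auto
  have disj: "disjoint_family_on E B"
    unfolding disjoint_family_on_def
  proof (intro ballI impI equals0I)
    fix y z F assume yz: "y \<in> B" "z \<in> B" "y \<noteq> z" "F \<in> E y \<inter> E z"
    then have "length y = n" "length z = n" using B by auto
    then have "map (flip X F) [0..<n] = y" "map (flip X F) [0..<n] = z"
      using mem_E[of y F] mem_E[of z F] yz(4) by blast+
    then show False using yz(3) by simp
  qed
  have meas_E: "measure (flips \<tau>) (E y) = noise_weight \<tau> (1 - \<tau>) (map X [0..<n]) y" if y: "length y = n" for y
  proof -
    have "emeasure (flips \<tau>) (E y) = (\<Prod>i<n. emeasure (measure_pmf (bernoulli_pmf \<tau>)) {y ! i \<noteq> X i})"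
      unfolding E_def flips_def by (rule emeasure_PiM_Collect) auto
    also have "\<dots> = (\<Prod>i<n. ennreal (if X i = y ! i then 1 - \<tau> else \<tau>))"
      using t by (intro prod.cong) (auto simp: emeasure_pmf_single)
    also have "\<dots> = ennreal (\<Prod>i<n. if X i = y ! i then 1 - \<tau> else \<tau>)"
      using t by (intro prod_ennreal) auto
    also have "(\<Prod>i<n. if X i = y ! i then 1 - \<tau> else \<tau>) = noise_weight \<tau> (1 - \<tau>) (map X [0..<n]) y"
      using y by (subst noise_weight_conv_prod) auto
    finally show ?thesis
      using t by (simp add: measure_def noise_weight_def)
  qed
  have "measure (flips \<tau>) (\<Union>y\<in>B. E y) = (\<Sum>y\<in>B. measure (flips \<tau>) (E y))"
    unfolding flips_def
    by (rule P.finite_measure_finite_Union) (use fin E_sets disj in \<open>auto simp: flips_def\<close>)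
  also have "\<dots> = (\<Sum>y\<in>B. noise_weight \<tau> (1 - \<tau>) (map X [0..<n]) y)"
    using B by (intro sum.cong meas_E) auto
  finally show ?prob unfolding eq .
qed

section \<open>The size of heavy sets\<close>

lemma entropy2_conv: "entropy2 x * ln 2 = nat_entropy x"
  by (simp add: entropy2_def nat_entropy_def log_def field_simps)

text \<open>Markov's inequality for the \<open>q\<close>-th moment of the noise probability,
  combined with the norm bound. All parameters are chosen before \<open>n\<close> and
  \<open>B\<close>, so that one enumerator can serve every length.\<close>

lemma card_heavy_bound:
  assumes p: "0 < p" "p < 1/2" and t: "0 < \<tau>" "\<tau> < 1/2"
    and \<beta>': "\<beta>' < entropy2 (noisy_bias p \<tau>)"
  shows "\<exists>(a::nat) (b::nat) (L::nat) D \<alpha>' c. L < D \<and> real D * \<tau> \<le> real a \<and> real D * (1 - \<tau>) \<le> real b \<and>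
    \<alpha>' < entropy2 p \<and> (\<forall>n B. (\<forall>n. B n \<subseteq> {y. length y = n}) \<longrightarrow> real (card (B n)) \<le> 2 * 2 powr (\<beta>' * n) \<longrightarrow>
      real (card (heavy a b L B n)) \<le> c * 2 powr (\<alpha>' * n))"
proof -
  define s where "s = slope p \<tau>"
  have s: "0 < s" unfolding s_def using slope_pos p t by auto
  \<comment> \<open>The exponent gains \<open>2 * \<eta>\<close> because \<open>card (B n)\<close>
    is governed by \<open>\<beta>'\<close>. The excess of \<open>M\<close> over its infimum spends
    \<open>\<eta>\<close>, and the threshold below spends \<open>\<eta> / 2\<close>, which leaves
    the rate \<open>entropy2 p - \<eta> / 2\<close>.\<close>
  define \<eta> where "\<eta> = (entropy2 (noisy_bias p \<tau>) - \<beta>') / (2 * s)"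
  have \<eta>: "0 < \<eta>" using \<beta>' s by (simp add: \<eta>_def)
  define M where "M = 2 powr (entropy2 p - entropy2 (noisy_bias p \<tau>) / s + \<eta>)"
  have M: "0 < M" by (simp add: M_def)
  have "exp (nat_entropy p - nat_entropy (noisy_bias p \<tau>) / s) = 2 powr (entropy2 p - entropy2 (noisy_bias p \<tau>) / s)"
    unfolding entropy2_conv[symmetric] by (simp add: powr_def algebra_simps)
  also have "\<dots> < M" using \<eta> by (simp add: M_def)
  finally obtain q where q: "0 < q" and ineq: "\<And>u v. 0 \<le> u \<Longrightarrow> 0 \<le> v \<Longrightarrow>
    ((1 - \<tau>) * u powr (1 / (s * real q)) + \<tau> * v powr (1 / (s * real q))) ^ q
    + (\<tau> * u powr (1 / (s * real q)) + (1 - \<tau>) * v powr (1 / (s * real q))) ^ q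
    \<le> M * (u + v) powr (1 / s)"
    using two_point_inequality[OF p t, of M] unfolding s_def by blast
  \<comment> \<open>Rounding \<open>D * \<tau>\<close> and \<open>D * (1 - \<tau>)\<close> up raises
    the total scale to at most \<open>D + 1 / \<tau>\<close>, and the threshold is
    \<open>D - 1\<close>. For large \<open>D\<close> the ratio is so close to 1 that even its
    \<open>q\<close>-th power costs little.\<close>
  have "(\<lambda>D. ((real D - 1) / (real D + 1 / \<tau>)) ^ q) \<longlonglongrightarrow> 1 ^ q"
    by (intro tendsto_power) real_asymp
  moreover have "2 powr (- \<eta> / 2) < 1 ^ q" using \<eta> by (simp add: powr_less_one)
  ultimately have "eventually (\<lambda>D. 2 powr (- \<eta> / 2) < ((real D - 1) / (real D + 1 / \<tau>)) ^ q) sequentially"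
    by (rule order_tendstoD(1))
  then have "eventually (\<lambda>D. 2 powr (- \<eta> / 2) < ((real D - 1) / (real D + 1 / \<tau>)) ^ q \<and> 1 < D) sequentially"
    using eventually_gt_at_top[of 1] by (rule eventually_conj)
  then obtain D :: nat where D: "1 < D" and D_q: "2 powr (- \<eta> / 2) < ((real D - 1) / (real D + 1 / \<tau>)) ^ q"
    by (auto simp: eventually_sequentially)
  define \<theta> where "\<theta> = (real D - 1) / (real D + 1 / \<tau>)"
  have dt: "0 < real D + 1 / \<tau>" using t by (simp add: add_nonneg_pos)
  have \<theta>: "0 < \<theta>" using D dt by (simp add: \<theta>_def)
  define a b where "a = nat \<lceil>real D * \<tau>\<rceil>" and "b = nat \<lceil>real D * (1 - \<tau>)\<rceil>"
  have a: "real D * \<tau> \<le> real a" "real a \<le> (real D + 1 / \<tau>) * \<tau>"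
    and b: "real D * (1 - \<tau>) \<le> real b" "real b \<le> (real D + 1 / \<tau>) * (1 - \<tau>)"
  proof -
    show "real D * \<tau> \<le> real a" "real D * (1 - \<tau>) \<le> real b"
      unfolding a_def b_def by (rule of_nat_ceiling)+
    have "real (nat \<lceil>x\<rceil>) \<le> x + 1" if "0 \<le> x" for x
      using that of_int_ceiling_le_add_one[of x] by simp
    then have "real a \<le> real D * \<tau> + 1" "real b \<le> real D * (1 - \<tau>) + 1"
      unfolding a_def b_def using t by auto
    \<comment> \<open>Since \<open>\<tau> < 1/2\<close>, a scale that absorbs the rounding of
      \<open>a\<close> also absorbs that of \<open>b\<close>.\<close>
    moreover have "1 \<le> (1 - \<tau>) / \<tau>" using t by (simp add: field_simps)
    moreover have "(real D + 1 / \<tau>) * \<tau> = real D * \<tau> + 1"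
      "(real D + 1 / \<tau>) * (1 - \<tau>) = real D * (1 - \<tau>) + (1 - \<tau>) / \<tau>"
      using t by (simp_all add: distrib_right)
    ultimately show "real a \<le> (real D + 1 / \<tau>) * \<tau>" "real b \<le> (real D + 1 / \<tau>) * (1 - \<tau>)"
      by (metis, metis add_left_mono order_trans)
  qed
  define c where "c = 2 powr (1 / s)"
  have "real (card (heavy a b (D - 1) B n)) \<le> c * 2 powr ((entropy2 p - \<eta> / 2) * n)"
    if B: "B n \<subseteq> {y. length y = n}" and card: "real (card (B n)) \<le> 2 * 2 powr (\<beta>' * n)" for B :: "nat \<Rightarrow> bool list set" and n
  proof -
    define P where "P x = (\<Sum>y\<in>B n. noise_weight \<tau> (1 - \<tau>) x y)" for x
    have P0: "0 \<le> P x" for x unfolding P_def noise_weight_def using t by (intro sum_nonneg) auto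
    let ?A = "heavy a b (D - 1) B n"
    have A: "?A \<subseteq> {x. length x = n}" by (auto simp: heavy_def)
    have P_ge: "\<theta> ^ n \<le> P x" if x: "x \<in> ?A" for x
    proof -
      have n: "length x = n" using x by (simp add: heavy_def)
      have "(D - 1) ^ n \<le> (\<Sum>y\<in>B n. noise_weight a b x y)"
        using x by (simp add: heavy_def noise_weight_def)
      then have "real ((D - 1) ^ n) \<le> real (\<Sum>y\<in>B n. noise_weight a b x y)" by (simp only: of_nat_le_iff)
      then have "(real D - 1) ^ n \<le> (\<Sum>y\<in>B n. noise_weight (real a) (real b) x y)"
        using D by (simp add: of_nat_noise_weight of_nat_diff)
      also have "\<dots> \<le> (\<Sum>y\<in>B n. noise_weight ((real D + 1 / \<tau>) * \<tau>) ((real D + 1 / \<tau>) * (1 - \<tau>)) x y)"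
        using a b by (intro sum_mono noise_weight_mono) auto
      also have "\<dots> = (real D + 1 / \<tau>) ^ n * P x"
        by (simp add: noise_weight_scale n P_def sum_distrib_left)
      finally show ?thesis using dt by (simp add: \<theta>_def power_divide pos_divide_le_eq mult.commute)
    qed
    \<comment> \<open>Every \<open>x\<close> in the heavy set contributes at least
      \<open>\<theta> ^ (n * q)\<close> to the moment.\<close>
    have "real (card ?A) * (\<theta> ^ n) ^ q = (\<Sum>x\<in>?A. (\<theta> ^ n) ^ q)" by simp
    also have "\<dots> \<le> (\<Sum>x\<in>?A. P x ^ q)"
      using \<theta> P_ge by (intro sum_mono power_mono) auto
    also have "\<dots> \<le> (\<Sum>x\<in>{x. length x = n}. P x ^ q)"
      by (rule sum_mono2[OF finite_length A]) (simp add: P0)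
    also have "\<dots> \<le> M ^ n * real (card (B n)) powr (1 / s)"
      unfolding P_def by (rule noise_norm_bound[OF ineq q s _ _ _ B]) (use t M in auto)
    also have "\<dots> \<le> M ^ n * (2 * 2 powr (\<beta>' * n)) powr (1 / s)"
      using card M s by (intro mult_left_mono powr_mono2) auto
    also have "\<dots> = c * 2 powr ((entropy2 p - \<eta>) * n)"
    proof -
      let ?e = "(entropy2 p - entropy2 (noisy_bias p \<tau>) / s + \<eta>) * n" and ?f = "\<beta>' / s * n"
      have "M ^ n = 2 powr ?e"
        by (simp add: M_def powr_powr powr_realpow[symmetric])
      moreover have "(2 * 2 powr (\<beta>' * n)) powr (1 / s) = c * 2 powr ?f"
        by (simp add: powr_mult powr_powr c_def)
      ultimately have "M ^ n * (2 * 2 powr (\<beta>' * n)) powr (1 / s) = c * 2 powr (?e + ?f)"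
        by (simp only: powr_add mult_ac)
      also have "?e + ?f = (entropy2 p - \<eta>) * n"
        using s by (simp add: \<eta>_def field_simps)
      finally show ?thesis .
    qed
    finally have "real (card ?A) * (\<theta> ^ n) ^ q \<le> c * 2 powr ((entropy2 p - \<eta>) * n)" .
    moreover have "2 powr (- \<eta> / 2 * n) \<le> (\<theta> ^ n) ^ q"
    proof -
      have "2 powr (- \<eta> / 2 * n) = (2 powr (- \<eta> / 2)) ^ n" by (simp add: powr_powr powr_realpow[symmetric])
      also have "\<dots> \<le> (\<theta> ^ q) ^ n" using D_q by (intro power_mono) (auto simp: \<theta>_def)
      finally show ?thesis by (simp add: power_mult[symmetric] mult.commute)
    qed
    ultimately have "real (card ?A) * 2 powr (- \<eta> / 2 * n) \<le> c * 2 powr ((entropy2 p - \<eta>) * n)"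
      by (meson mult_left_mono of_nat_0_le_iff order_trans)
    then have "real (card ?A) * 2 powr (- \<eta> / 2 * n) * 2 powr (\<eta> / 2 * n) \<le> c * 2 powr ((entropy2 p - \<eta>) * n) * 2 powr (\<eta> / 2 * n)"
      by (rule mult_right_mono) simp
    moreover have "(entropy2 p - \<eta>) * n + \<eta> / 2 * n = (entropy2 p - \<eta> / 2) * n" by (simp add: algebra_simps)
    ultimately show ?thesis by (simp add: mult.assoc powr_add[symmetric])
  qed
  then show ?thesis
    using D a(1) b(1) \<eta>
    by (intro exI[of _ a] exI[of _ b] exI[of _ "D - 1"] exI[of _ D] exI[of _ "entropy2 p - \<eta> / 2"] exI[of _ c]) auto
qed

section \<open>Effective dimension\<close>

text \<open>Rates are taken rational so that the size bounds \<open>2 ^ (u * n div w)\<close> are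
  computable, although the entropies need not be.\<close>

lemma rational_between:
  fixes x y :: real
  assumes "0 \<le> x" "x < y"
  obtains u w :: nat where "0 < w" "x < real u / real w" "real u / real w < y"
proof -
  obtain r where r: "r \<in> \<rat>" "x < r" "r < y" using Rats_dense_in_real[OF assms(2)] by auto
  obtain u w :: nat where "w \<noteq> 0" "\<bar>r\<bar> = real u / real w"
    using r(1) by (rule Rats_abs_nat_div_natE) 
  then show thesis using that[of w u] r assms(1) by simp
qed

lemma entropy2_pos:
  assumes "0 < x" "x < 1"
  shows "0 < entropy2 x"
proof -
  have "0 < - ln x" "0 < - ln (1 - x)" using assms by auto
  then have "0 < x * - ln x + (1 - x) * - ln (1 - x)"
    using assms by (intro add_pos_pos mult_pos_pos) auto
  then have "0 < entropy2 x * ln 2" unfolding entropy2_conv by (simp add: nat_entropy_def)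
  then show ?thesis by (simp add: zero_less_mult_iff)
qed

lemma real_nat_div_bounds:
  "real (m div w) \<le> real m / real w" "real m / real w < real (m div w) + 1"
  using floor_divide_of_nat_eq[of m w, where 'a = real] by linarith+

lemma power_div_bounds:
  assumes "0 < w"
  shows "2 ^ (u * n div w) \<le> 2 powr (real u / real w * real n)"
    and "2 powr (real u / real w * real n) \<le> 2 * 2 ^ (u * n div w)"
proof -
  have "real (u * n div w) \<le> real (u * n) / real w" by (rule real_nat_div_bounds)
  then have 1: "real (u * n div w) \<le> real u / real w * real n" by simp
  have "real (u * n) / real w \<le> real (u * n div w) + 1"
    using real_nat_div_bounds(2)[of "u * n" w] by linarith
  then have 2: "real u / real w * real n \<le> real (u * n div w) + 1" by simp
  show "2 ^ (u * n div w) \<le> 2 powr (real u / real w * real n)"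
    using 1 by (simp add: powr_realpow[symmetric])
  have "2 powr (real u / real w * real n) \<le> 2 powr (real (u * n div w) + 1)"
    using 2 by simp
  then show "2 powr (real u / real w * real n) \<le> 2 * 2 ^ (u * n div w)"
    by (simp add: powr_add powr_realpow)
qed

lemma computable_exponential: "computable 1 (\<lambda>e. k * 2 ^ (u * (e ! 0) div w + 1))"
  by (intro computable_mult computable_power computable_add computable_div computable_vars) auto

lemma card_describable: "card (describable U R n) \<le> R n"
proof -
  have "describable U R n \<subseteq> (\<lambda>P. the (U (inv code P))) ` {..<R n}"
  proof
    fix y assume "y \<in> describable U R n"
    then obtain p where "U p = Some y" "code p < R n" by (auto simp: describable_def)
    moreover have "inv code (code p) = p" using bij_code by (simp add: bij_is_inj)
    ultimately show "y \<in> (\<lambda>P. the (U (inv code P))) ` {..<R n}"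
      by (intro image_eqI[of _ _ "code p"]) auto
  qed
  from surj_card_le[OF _ this] show ?thesis by simp
qed

text \<open>Phrased through finite upper bounds \<open>m\<close>, so that infinite complexity needs
  no separate treatment.\<close>

lemma eff_dim_eventually:
  assumes "ereal r < eff_dim U X"
  shows "eventually (\<lambda>n. \<forall>m. complexity U (map X [0..<n]) \<le> enat m \<longrightarrow> r * real n < real m) sequentially"
proof -
  have "eventually (\<lambda>n. ereal r < ereal_of_enat (complexity U (map X [0..<n])) / ereal (real n)) sequentially"
    using assms unfolding eff_dim_def by (rule less_LiminfD)
  then show ?thesis using eventually_gt_at_top[of 0]
  proof eventually_elim
    case (elim n)
    show ?case
    proof (intro allI impI)
      fix m assume "complexity U (map X [0..<n]) \<le> enat m"
      then have "ereal_of_enat (complexity U (map X [0..<n])) \<le> ereal_of_enat (enat m)"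
        by (simp only: ereal_of_enat_le_iff)
      then have "ereal_of_enat (complexity U (map X [0..<n])) / ereal (real n) \<le> ereal (real m) / ereal (real n)"
        using elim(2) by (intro ereal_divide_right_mono) auto
      with elim(1) have "ereal r < ereal (real m) / ereal (real n)" by (rule less_le_trans)
      then show "r * real n < real m" using elim(2) by (simp add: pos_less_divide_eq)
    qed
  qed
qed

text \<open>A heavy prefix is given by its index among at most \<open>G n\<close> strings together
  with \<open>n\<close>, so its complexity is at most \<open>\<gamma> * n + O(log n)\<close> for a
  rate \<open>\<gamma> < \<alpha>\<close>. For large \<open>n\<close> this contradicts the dimension
  of \<open>X\<close>.\<close>

lemma eventually_not_heavy:
  assumes U: "optimal U" and X: "ereal \<alpha> \<le> eff_dim U X" and R: "computable 1 (\<lambda>e. R (e ! 0))"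
    and \<alpha>: "0 < \<alpha>" "\<alpha>' < \<alpha>"
    and card: "\<And>n. real (card (heavy a b L (describable U R) n)) \<le> c * 2 powr (\<alpha>' * n)"
  shows "eventually (\<lambda>n. map X [0..<n] \<notin> heavy a b L (describable U R) n) sequentially"
proof -
  let ?H = "heavy a b L (describable U R)"
  have "0 \<le> max \<alpha>' 0" "max \<alpha>' 0 < \<alpha>" using \<alpha> by auto
  then obtain u w :: nat where w: "0 < w" and uw: "max \<alpha>' 0 < real u / real w" "real u / real w < \<alpha>"
    by (rule rational_between)
  define \<gamma> where "\<gamma> = real u / real w"
  \<comment> \<open>An integer factor absorbing \<open>c\<close>, made positive by the added 1. In
    \<open>G\<close> the extra factor 2 compensates the rounding down in the exponent.\<close>
  define g where "g = nat \<lceil>c\<rceil> + 1"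
  define G where "G n = g * 2 ^ (u * n div w + 1)" for n
  have g: "0 < g" "c \<le> real g" by (auto simp: g_def) linarith
  have G: "computable 1 (\<lambda>e. G (e ! 0))" unfolding G_def by (rule computable_exponential)
  have mono: "mono G"
    unfolding G_def by (intro monoI mult_le_mono power_increasing add_right_mono div_le_mono) auto
  have pos: "0 < G n" for n using g by (simp add: G_def)
  have card_G: "card (?H n) \<le> G n" for n
  proof -
    have "real (card (?H n)) \<le> c * 2 powr (\<alpha>' * n)" by (rule card)
    also have "\<dots> \<le> real g * 2 powr (\<gamma> * n)"
      using g uw by (intro mult_mono powr_mono mult_right_mono) (auto simp: \<gamma>_def)
    also have "\<dots> \<le> real g * (2 * 2 ^ (u * n div w))"
      unfolding \<gamma>_def by (intro mult_left_mono power_div_bounds w) auto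
    also have "\<dots> = real (G n)" by (simp add: G_def)
    finally show ?thesis by (simp only: of_nat_le_iff)
  qed
  obtain d where d: "\<forall>n m. \<forall>x\<in>?H n. (n + 1) * G n \<le> 2 ^ m \<longrightarrow> complexity U x \<le> enat (m + d)"
    using complexity_heavy[OF U R G mono pos card_G] by blast
  obtain r where r: "\<gamma> < r" "r < \<alpha>" using dense uw(2) unfolding \<gamma>_def by blast
  from r(2) have "ereal r < ereal \<alpha>" by simp
  then have "ereal r < eff_dim U X" using X by (rule less_le_trans)
  note ev = eff_dim_eventually[OF this]
  have "(\<lambda>n. (log 2 ((real n + 1) * real g) + 2 + real d) / real n) \<longlonglongrightarrow> 0"
    using g by real_asymp
  then have "eventually (\<lambda>n. (log 2 ((real n + 1) * real g) + 2 + real d) / real n < r - \<gamma>) sequentially"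
    using r by (intro order_tendstoD) auto
  then show ?thesis using ev eventually_gt_at_top[of 0]
  proof eventually_elim
    case (elim n)
    show ?case
    proof
      assume x: "map X [0..<n] \<in> ?H n"
      \<comment> \<open>The bits spent on \<open>n\<close> and on the constant factor; the
        hypothesis on \<open>n\<close> makes this overhead smaller than
        \<open>(r - \<gamma>) * n\<close>.\<close>
      define k where "k = nat \<lceil>log 2 ((real n + 1) * real g)\<rceil>"
      have "1 * 1 \<le> (real n + 1) * real g" using g by (intro mult_mono) auto
      then have l: "0 \<le> log 2 ((real n + 1) * real g)" "0 < (real n + 1) * real g" by simp_all
      have "log 2 ((real n + 1) * real g) \<le> real k" unfolding k_def by (rule of_nat_ceiling)
      then have "(real n + 1) * real g \<le> 2 powr real k" using l(2) by (simp add: log_le_iff)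
      then have "real ((n + 1) * g) \<le> real (2 ^ k)" by (simp add: powr_realpow algebra_simps)
      then have "(n + 1) * g \<le> 2 ^ k" by (simp only: of_nat_le_iff)
      then have "(n + 1) * g * 2 ^ (u * n div w + 1) \<le> 2 ^ k * 2 ^ (u * n div w + 1)" by (rule mult_le_mono1)
      then have "(n + 1) * G n \<le> 2 ^ (k + (u * n div w + 1))" by (simp only: G_def power_add mult.assoc)
      with d x have "complexity U (map X [0..<n]) \<le> enat (k + (u * n div w + 1) + d)" by blast
      with elim(2) have "r * real n < real (k + (u * n div w + 1) + d)" by blast
      moreover have "real k \<le> log 2 ((real n + 1) * real g) + 1"
        using l(1) of_int_ceiling_le_add_one[of "log 2 ((real n + 1) * real g)"] by (simp add: k_def)
      moreover have "real (u * n div w) \<le> \<gamma> * real n"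
        using real_nat_div_bounds(1)[of "u * n" w] by (simp add: \<gamma>_def)
      ultimately have "r * real n < log 2 ((real n + 1) * real g) + 2 + real d + \<gamma> * real n" by simp
      moreover have "log 2 ((real n + 1) * real g) + 2 + real d < (r - \<gamma>) * real n"
        using elim(1,3) by (simp add: pos_divide_less_eq)
      ultimately show False by (simp add: left_diff_distrib)
    qed
  qed
qed

text \<open>For a prefix outside the heavy set the scaled weight of the describable strings is below
  \<open>L ^ n\<close>, so the noisy prefix is describable with probability at most
  \<open>(L / D) ^ n\<close>. These bounds are summable, and Borel--Cantelli applies.\<close>

lemma AE_eventually_not_describable:
  fixes u w :: nat
  assumes U: "optimal U" and p: "0 < p" "p < 1/2" and t: "0 < \<tau>" "\<tau> < 1/2"
    and X: "ereal (entropy2 p) \<le> eff_dim U X"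
    and w: "0 < w" and uw: "real u / real w < entropy2 (noisy_bias p \<tau>)"
  defines "R \<equiv> \<lambda>n. 2 ^ (u * n div w + 1)"
  shows "AE F in flips \<tau>. eventually (\<lambda>n. map (flip X F) [0..<n] \<notin> describable U R n) sequentially"
proof -
  let ?B = "describable U R"
  obtain a b L D :: nat and \<alpha>' c where LD: "L < D" and a: "real D * \<tau> \<le> real a" and b: "real D * (1 - \<tau>) \<le> real b"
    and \<alpha>': "\<alpha>' < entropy2 p"
    and heavy: "\<And>n B. (\<And>n. B n \<subseteq> {y. length y = n}) \<Longrightarrow> real (card (B n)) \<le> 2 * 2 powr (real u / real w * n) \<Longrightarrow>
      real (card (heavy a b L B n)) \<le> c * 2 powr (\<alpha>' * n)"
    using card_heavy_bound[OF p t uw] by metis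
  have "real (card (?B n)) \<le> 2 * 2 powr (real u / real w * n)" for n
  proof -
    have "real (card (?B n)) \<le> real (R n)" using card_describable by (simp only: of_nat_le_iff)
    also have "\<dots> = 2 * 2 ^ (u * n div w)" by (simp add: R_def)
    also have "\<dots> \<le> 2 * 2 powr (real u / real w * n)" by (intro mult_left_mono power_div_bounds w) auto
    finally show ?thesis .
  qed
  then have card: "real (card (heavy a b L ?B n)) \<le> c * 2 powr (\<alpha>' * n)" for n
    by (intro heavy describable_subset)
  have R: "computable 1 (\<lambda>e. R (e ! 0))" using computable_exponential[of 1 u w] by (simp only: R_def mult_1)
  have not_heavy: "eventually (\<lambda>n. map X [0..<n] \<notin> heavy a b L ?B n) sequentially"
    by (rule eventually_not_heavy[OF U X R _ \<alpha>' card]) (use entropy2_pos p in auto)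
  define E where "E n = {F \<in> space (flips \<tau>). map (flip X F) [0..<n] \<in> ?B n}" for n
  have t': "0 \<le> \<tau>" "\<tau> \<le> 1" using t by auto
  have noisy: "E n \<in> sets (flips \<tau>)"
    "measure (flips \<tau>) (E n) = (\<Sum>y\<in>?B n. noise_weight \<tau> (1 - \<tau>) (map X [0..<n]) y)" for n
    unfolding E_def by (rule prob_noisy_prefix[OF t' describable_subset])+
  have bound: "measure (flips \<tau>) (E n) \<le> (real L / real D) ^ n" if n: "map X [0..<n] \<notin> heavy a b L ?B n" for n
  proof -
    let ?x = "map X [0..<n]"
    have D: "0 < real D" using LD by simp
    have "real D ^ n * measure (flips \<tau>) (E n) = (\<Sum>y\<in>?B n. noise_weight (real D * \<tau>) (real D * (1 - \<tau>)) ?x y)"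
      unfolding noisy(2) by (simp add: noise_weight_scale sum_distrib_left)
    also have "\<dots> \<le> (\<Sum>y\<in>?B n. noise_weight (real a) (real b) ?x y)"
      using a b t by (intro sum_mono noise_weight_mono) auto
    also have "\<dots> = real (\<Sum>y\<in>?B n. noise_weight a b ?x y)" by (simp add: of_nat_noise_weight)
    also have "\<dots> \<le> real (L ^ n)"
      using n by (simp only: of_nat_le_iff) (simp add: heavy_def noise_weight_def)
    finally show ?thesis using D by (simp add: power_divide pos_le_divide_eq mult.commute)
  qed
  interpret prob_space "flips \<tau>"
    unfolding flips_def by (intro prob_space_PiM prob_space_measure_pmf)
  have "summable (\<lambda>n. measure (flips \<tau>) (E n))"
  proof (rule summable_comparison_test_ev)
    show "eventually (\<lambda>n. norm (measure (flips \<tau>) (E n)) \<le> (real L / real D) ^ n) sequentially"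
      using not_heavy by eventually_elim (simp add: bound)
    show "summable (\<lambda>n. (real L / real D) ^ n)" using LD by (intro summable_geometric) simp
  qed
  then have "AE F in flips \<tau>. eventually (\<lambda>n. F \<in> space (flips \<tau>) - E n) sequentially"
    using noisy(1) by (intro borel_cantelli_AE1) (auto simp: emeasure_eq_measure)
  then show ?thesis
    by (rule AE_mp) (auto intro!: AE_I2 elim!: eventually_mono simp: E_def)
qed

lemma not_describable_complexity:
  fixes u w :: nat
  assumes n: "0 < n" and w: "0 < w" and y: "length y = n" "y \<notin> describable U (\<lambda>n. 2 ^ (u * n div w + 1)) n"
  shows "ereal (real u / real w) \<le> ereal_of_enat (complexity U y) / ereal (real n)"
proof -
  have "enat (u * n div w + 1) \<le> enat (length p)" if "U p = Some y" for p
  proof -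
    \<comment> \<open>Any program for \<open>y\<close> has number at least
      \<open>2 ^ (u * n div w + 1)\<close>, hence length at least \<open>u * n div w + 1\<close>;
      the added 1 makes up for the rounding in \<open>div\<close>.\<close>
    have "2 ^ (u * n div w + 1) \<le> code p" using that y by (auto simp: describable_def not_less)
    also have "\<dots> < 2 ^ (length p + 1)" using code_eq[of p] bits_val_less[of p] by simp
    finally show ?thesis by (simp del: power_Suc)
  qed
  then have "enat (u * n div w + 1) \<le> complexity U y"
    unfolding complexity_def by (intro INF_greatest) auto
  then have "ereal_of_enat (enat (u * n div w + 1)) \<le> ereal_of_enat (complexity U y)"
    by (simp only: ereal_of_enat_le_iff)
  then have *: "ereal (real (u * n div w + 1)) / ereal (real n) \<le> ereal_of_enat (complexity U y) / ereal (real n)"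
    using n by (intro ereal_divide_right_mono) auto
  have "real (u * n) / real w \<le> real (u * n div w) + 1"
    using real_nat_div_bounds(2)[of "u * n" w] by linarith
  then have "real u / real w \<le> real (u * n div w + 1) / real n"
    using n by (simp add: pos_le_divide_eq)
  then have "ereal (real u / real w) \<le> ereal (real (u * n div w + 1)) / ereal (real n)"
    using n by simp
  then show ?thesis using * by (rule order_trans)
qed

theorem theorem3:
  fixes U :: "bool list \<Rightarrow> bool list option"
    and p \<tau> \<alpha> \<beta> :: real
    and X :: "nat \<Rightarrow> bool"
  assumes "optimal U"
    and "p \<in> {0<..<1/2}" and "\<tau> \<in> {0<..<1/2}"
    and "\<alpha> = entropy2 p" and "\<beta> = entropy2 (noisy_bias p \<tau>)"
    and "eff_dim U X \<ge> ereal \<alpha>"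
  shows "AE F in flips \<tau>. eff_dim U (flip X F) \<ge> ereal \<beta>"
proof -
  have p: "0 < p" "p < 1/2" and t: "0 < \<tau>" "\<tau> < 1/2" using assms by auto
  have \<beta>: "0 < \<beta>" unfolding assms(5) using p t by (intro entropy2_pos noisy_bias_unit) auto
  let ?ev = "\<lambda>F (u::nat) (w::nat). eventually (\<lambda>n. map (flip X F) [0..<n] \<notin>
    describable U (\<lambda>n. 2 ^ (u * n div w + 1)) n) sequentially"
  have "AE F in flips \<tau>. 0 < w \<longrightarrow> real u / real w < \<beta> \<longrightarrow> ?ev F u w" for u w
    using AE_eventually_not_describable[OF assms(1) p t, of X w u] assms(4-6)
    by (cases "0 < w \<and> real u / real w < \<beta>") auto
  \<comment> \<open>There are countably many pairs \<open>u\<close>, \<open>w\<close>, so a single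
    null set serves for all rational rates below \<open>\<beta>\<close>.\<close>
  then have "AE F in flips \<tau>. \<forall>u w. 0 < w \<longrightarrow> real u / real w < \<beta> \<longrightarrow> ?ev F u w"
    unfolding AE_all_countable by blast
  then show ?thesis
  proof (rule AE_mp, intro AE_I2 impI)
    fix F assume F: "\<forall>u w. 0 < w \<longrightarrow> real u / real w < \<beta> \<longrightarrow> ?ev F u w"
    show "ereal \<beta> \<le> eff_dim U (flip X F)"
      unfolding eff_dim_def le_Liminf_iff
    proof (intro allI impI)
      fix y assume y: "y < ereal \<beta>"
      then obtain z where z: "y < ereal z" "z < \<beta>"
        by (metis ereal_dense2 ereal_less_eq(3) less_ereal.simps(1))
      \<comment> \<open>Natural numerator and denominator require a nonnegative lower end;
        \<open>\<beta> > 0\<close> keeps the interval nonempty.\<close>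
      have "0 \<le> max z 0" "max z 0 < \<beta>" using z \<beta> by auto
      then obtain u w :: nat where uw: "0 < w" "max z 0 < real u / real w" "real u / real w < \<beta>"
        by (rule rational_between)
      have "y < ereal (real u / real w)"
        using z(1) uw(2) by (auto intro: less_trans)
      have "?ev F u w" using F uw by blast
      then show "eventually (\<lambda>n. y < ereal_of_enat (complexity U (map (flip X F) [0..<n])) / ereal (real n)) sequentially"
        using eventually_gt_at_top[of 0]
      proof eventually_elim
        case (elim n)
        have "ereal (real u / real w) \<le> ereal_of_enat (complexity U (map (flip X F) [0..<n])) / ereal (real n)"
          using not_describable_complexity[OF elim(2) uw(1) _ elim(1)] by simp
        with \<open>y < ereal (real u / real w)\<close> show ?case by (rule less_le_trans)
      qed
    qed
  qed
qed

end
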